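(* For every $n\ge 0$, the family $(Q_x)_{x\in\mathsf{Y}_n}$ is a basis of the abelian group $\mathbf{V}(2n+1)$.
   Context: One works with graded abelian groups and the Koszul sign rule. A (nonsymmetric) operad $\mathbf{P}$ is a collection of graded abelian groups $\mathbf{P}(n)=\bigoplus_{k\in\mathbb{Z}}\mathbf{P}(n)_k$, $n\ge 1$, with a unit $\boldsymbol{1}\in\mathbf{P}(1)_0$ (neutral for all compositions) and weight-additive linear maps $\circ_i:\mathbf{P}(m)\otimes\mathbf{P}(n)\to\mathbf{P}(m+n-1)$, $1\le i\le m$, satisfying $(a\circ_i b)\circ_{j+i-1}c=a\circ_i(b\circ_j c)$ and, for $i<j$, $(a\circ_i b)\circ_{j+\#b-1}c=(-1)^{bc}(a\circ_j c)\circ_i b$. For $a\in\mathbf{P}(n)_k$, $\#a=n$ is the degree and $k$ the weight; in exponents of $-1$ the letter $a$ denotes the weight of $a$. Write $a\circ_{\max}b=a\circ_{\#a}b$. The operad $\mathbf{V}$ is presented by one generator $g$ of degree $3$ and weight $1$ with the single relation $g\circ_1 g-g\circ_2 g+g\circ_3 g=0$. $\mathsf{Y}_n$ is the set of planar binary trees with $n$ internal (trivalent) vertices. Such a tree is either the trivial tree $|$ ($n=0$) or decomposes uniquely as a pair $(x,y)$ of planar binary trees (left and right subtrees at the root vertex). Define $Q_x\in\mathbf{V}(2n+1)_n$ for $x\in\mathsf{Y}_n$ recursively by $Q_{|}=\boldsymbol{1}$ and, for $z=(x,y)$, $Q_z=(-1)^{Q_x+Q_xQ_y}(g\circ_3Q_y)\circ_1Q_x=(-1)^{Q_x}(g\circ_1Q_x)\circ_{\max}Q_y$.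 *)

theory Defs
  imports "HOL-Algebra.Algebra"
begin

section \<open>Nonsymmetric operads in graded abelian groups\<close>

text \<open>
  A graded abelian group is given by the family of its homogeneous components, which are
  abelian groups in the (multiplicatively written) sense of HOL-Algebra: sums are written
  as products, opposites as inverses and integer multiples as powers.
  \<open>component P n k\<close> is \<open>P(n)\<^sub>k\<close>, of degree (arity) \<open>n\<close> and weight \<open>k\<close>.
  A weight-additive linear map out of the tensor product of \<open>P(m)\<close> and \<open>P(n)\<close> is
  the same as a family of biadditive maps on the homogeneous components;
  \<open>circ P m k n l i\<close> is the restriction of the \<open>i\<close>-th composition to \<open>P(m)\<^sub>k\<close> and \<open>P(n)\<^sub>l\<close>.
  The components for \<open>n = 0\<close> are not part of the structure.
\<close>

record 'a graded_operad =
  component :: "nat \<Rightarrow> int \<Rightarrow> 'a monoid"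
  opunit :: 'a
  circ :: "nat \<Rightarrow> int \<Rightarrow> nat \<Rightarrow> int \<Rightarrow> nat \<Rightarrow> 'a \<Rightarrow> 'a \<Rightarrow> 'a"

text \<open>\<open>signed G k a\<close> is \<open>(-1)\<^sup>k a\<close> in the abelian group \<open>G\<close>.\<close>

definition signed :: "('a, 'c) monoid_scheme \<Rightarrow> int \<Rightarrow> 'a \<Rightarrow> 'a"
  where "signed G k a = (if even k then a else inv\<^bsub>G\<^esub> a)"

lemma (in group) signed_signed:
  "a \<in> carrier G \<Longrightarrow> signed G j (signed G k a) = signed G (j + k) a"
  by (simp add: signed_def)

locale operad =
  fixes P :: "('a, 'c) graded_operad_scheme"
  assumes comm_group_component: "1 \<le> n \<Longrightarrow> comm_group (component P n k)"
    and unit_closed: "opunit P \<in> carrier (component P 1 0)"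
    and circ_closed:
      "\<lbrakk>1 \<le> i; i \<le> m; 1 \<le> n; a \<in> carrier (component P m k); b \<in> carrier (component P n l)\<rbrakk>
        \<Longrightarrow> circ P m k n l i a b \<in> carrier (component P (m + n - 1) (k + l))"
    and circ_add_left:
      "\<lbrakk>1 \<le> i; i \<le> m; 1 \<le> n; a \<in> carrier (component P m k); a' \<in> carrier (component P m k);
        b \<in> carrier (component P n l)\<rbrakk>
        \<Longrightarrow> circ P m k n l i (a \<otimes>\<^bsub>component P m k\<^esub> a') b =
            circ P m k n l i a b \<otimes>\<^bsub>component P (m + n - 1) (k + l)\<^esub> circ P m k n l i a' b"
    and circ_add_right:
      "\<lbrakk>1 \<le> i; i \<le> m; 1 \<le> n; a \<in> carrier (component P m k);
        b \<in> carrier (component P n l); b' \<in> carrier (component P n l)\<rbrakk>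
        \<Longrightarrow> circ P m k n l i a (b \<otimes>\<^bsub>component P n l\<^esub> b') =
            circ P m k n l i a b \<otimes>\<^bsub>component P (m + n - 1) (k + l)\<^esub> circ P m k n l i a b'"
    and unit_left: "\<lbrakk>1 \<le> n; b \<in> carrier (component P n l)\<rbrakk> \<Longrightarrow> circ P 1 0 n l 1 (opunit P) b = b"
    and unit_right:
      "\<lbrakk>1 \<le> i; i \<le> m; a \<in> carrier (component P m k)\<rbrakk> \<Longrightarrow> circ P m k 1 0 i a (opunit P) = a"
    and circ_nested:
      "\<lbrakk>1 \<le> i; i \<le> m; 1 \<le> j; j \<le> n; 1 \<le> p; a \<in> carrier (component P m k);
        b \<in> carrier (component P n l); c \<in> carrier (component P p q)\<rbrakk>
        \<Longrightarrow> circ P (m + n - 1) (k + l) p q (j + i - 1) (circ P m k n l i a b) c =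
            circ P m k (n + p - 1) (l + q) i a (circ P n l p q j b c)"
    and circ_parallel:
      "\<lbrakk>1 \<le> i; i < j; j \<le> m; 1 \<le> n; 1 \<le> p; a \<in> carrier (component P m k);
        b \<in> carrier (component P n l); c \<in> carrier (component P p q)\<rbrakk>
        \<Longrightarrow> circ P (m + n - 1) (k + l) p q (j + n - 1) (circ P m k n l i a b) c =
            signed (component P (m + n + p - 2) (k + l + q)) (l * q)
              (circ P (m + p - 1) (k + q) n l i (circ P m k p q j a c) b)"

definition operad_hom ::
  "('a, 'c) graded_operad_scheme \<Rightarrow> ('b, 'd) graded_operad_scheme \<Rightarrow> (nat \<Rightarrow> int \<Rightarrow> 'a \<Rightarrow> 'b) \<Rightarrow> bool"
  where "operad_hom P P' \<phi> \<longleftrightarrow>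
    (\<forall>n k. 1 \<le> n \<longrightarrow> \<phi> n k \<in> hom (component P n k) (component P' n k)) \<and>
    \<phi> 1 0 (opunit P) = opunit P' \<and>
    (\<forall>m k n l i a b. 1 \<le> i \<longrightarrow> i \<le> m \<longrightarrow> 1 \<le> n \<longrightarrow>
      a \<in> carrier (component P m k) \<longrightarrow> b \<in> carrier (component P n l) \<longrightarrow>
      \<phi> (m + n - 1) (k + l) (circ P m k n l i a b) = circ P' m k n l i (\<phi> m k a) (\<phi> n l b))"

text \<open>\<open>total_group P n\<close> is the abelian group \<open>P(n)\<close>, the direct sum of all \<open>P(n)\<^sub>k\<close>, whose elements are
  functions of the weight; \<open>incl P n k\<close> is the inclusion of the summand \<open>P(n)\<^sub>k\<close>.\<close>

definition total_group :: "('a, 'c) graded_operad_scheme \<Rightarrow> nat \<Rightarrow> (int \<Rightarrow> 'a) monoid"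
  where "total_group P n = sum_group UNIV (component P n)"

definition incl :: "('a, 'c) graded_operad_scheme \<Rightarrow> nat \<Rightarrow> int \<Rightarrow> 'a \<Rightarrow> (int \<Rightarrow> 'a)"
  where "incl P n k a = (\<lambda>j. if j = k then a else \<one>\<^bsub>component P n j\<^esub>)"


section \<open>Operads presented by generators and relations\<close>

text \<open>
  \<open>dg\<close> and \<open>wg\<close> give the degrees and weights of the generators, and \<open>R\<close> is the set of relators
  (the elements set to zero). The presented operad consists of all formal expressions in the
  generators, modulo the smallest congruence that enforces the operad axioms and the relations.
\<close>

datatype 'g opterm =
    Unit
  | Gen 'g
  | Zero nat int
  | Neg "'g opterm"
  | Add "'g opterm" "'g opterm"
  | Comp nat "'g opterm" "'g opterm"

definition sgn_term :: "int \<Rightarrow> 'g opterm \<Rightarrow> 'g opterm"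
  where "sgn_term k t = (if even k then t else Neg t)"

locale operad_presentation =
  fixes dg :: "'g \<Rightarrow> nat" and wg :: "'g \<Rightarrow> int" and R :: "'g opterm set"
begin

primrec deg :: "'g opterm \<Rightarrow> nat" where
  "deg Unit = 1"
| "deg (Gen x) = dg x"
| "deg (Zero n k) = n"
| "deg (Neg t) = deg t"
| "deg (Add s t) = deg s"
| "deg (Comp i s t) = deg s + deg t - 1"

primrec wt :: "'g opterm \<Rightarrow> int" where
  "wt Unit = 0"
| "wt (Gen x) = wg x"
| "wt (Zero n k) = k"
| "wt (Neg t) = wt t"
| "wt (Add s t) = wt s"
| "wt (Comp i s t) = wt s + wt t"

primrec wft :: "'g opterm \<Rightarrow> bool" where
  "wft Unit \<longleftrightarrow> True"
| "wft (Gen x) \<longleftrightarrow> 1 \<le> dg x"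
| "wft (Zero n k) \<longleftrightarrow> 1 \<le> n"
| "wft (Neg t) \<longleftrightarrow> wft t"
| "wft (Add s t) \<longleftrightarrow> wft s \<and> wft t \<and> deg s = deg t \<and> wt s = wt t"
| "wft (Comp i s t) \<longleftrightarrow> wft s \<and> wft t \<and> 1 \<le> i \<and> i \<le> deg s"

inductive eqv :: "'g opterm \<Rightarrow> 'g opterm \<Rightarrow> bool" (infix \<open>\<doteq>\<close> 50) where
  refl: "wft t \<Longrightarrow> t \<doteq> t"
| sym: "s \<doteq> t \<Longrightarrow> t \<doteq> s"
| trans: "s \<doteq> t \<Longrightarrow> t \<doteq> u \<Longrightarrow> s \<doteq> u"
| cong_Neg: "s \<doteq> t \<Longrightarrow> Neg s \<doteq> Neg t"
| cong_Add: "s \<doteq> s' \<Longrightarrow> t \<doteq> t' \<Longrightarrow> wft (Add s t) \<Longrightarrow> Add s t \<doteq> Add s' t'"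
| cong_Comp: "s \<doteq> s' \<Longrightarrow> t \<doteq> t' \<Longrightarrow> wft (Comp i s t) \<Longrightarrow> Comp i s t \<doteq> Comp i s' t'"
| Add_assoc: "wft (Add (Add s t) u) \<Longrightarrow> Add (Add s t) u \<doteq> Add s (Add t u)"
| Add_commute: "wft (Add s t) \<Longrightarrow> Add s t \<doteq> Add t s"
| Add_Zero: "wft t \<Longrightarrow> Add (Zero (deg t) (wt t)) t \<doteq> t"
| Add_Neg: "wft t \<Longrightarrow> Add (Neg t) t \<doteq> Zero (deg t) (wt t)"
| Comp_Add_left:
    "wft (Comp i (Add s s') t) \<Longrightarrow> Comp i (Add s s') t \<doteq> Add (Comp i s t) (Comp i s' t)"
| Comp_Add_right:
    "wft (Comp i s (Add t t')) \<Longrightarrow> Comp i s (Add t t') \<doteq> Add (Comp i s t) (Comp i s t')"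
| Unit_left: "wft t \<Longrightarrow> Comp 1 Unit t \<doteq> t"
| Unit_right: "wft (Comp i t Unit) \<Longrightarrow> Comp i t Unit \<doteq> t"
| Comp_nested:
    "wft s \<Longrightarrow> wft t \<Longrightarrow> wft u \<Longrightarrow> 1 \<le> i \<Longrightarrow> i \<le> deg s \<Longrightarrow> 1 \<le> j \<Longrightarrow> j \<le> deg t \<Longrightarrow>
      Comp (j + i - 1) (Comp i s t) u \<doteq> Comp i s (Comp j t u)"
| Comp_parallel:
    "wft s \<Longrightarrow> wft t \<Longrightarrow> wft u \<Longrightarrow> 1 \<le> i \<Longrightarrow> i < j \<Longrightarrow> j \<le> deg s \<Longrightarrow>
      Comp (j + deg t - 1) (Comp i s t) u \<doteq> sgn_term (wt t * wt u) (Comp i (Comp j s u) t)"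
| relator: "r \<in> R \<Longrightarrow> wft r \<Longrightarrow> r \<doteq> Zero (deg r) (wt r)"

definition cls :: "'g opterm \<Rightarrow> 'g opterm set"
  where "cls t = {s. t \<doteq> s}"

definition presented_component :: "nat \<Rightarrow> int \<Rightarrow> 'g opterm set monoid"
  where "presented_component n k =
    \<lparr>carrier = cls ` {t. wft t \<and> deg t = n \<and> wt t = k},
     monoid.mult = (\<lambda>A B. \<Union>s\<in>A. \<Union>t\<in>B. cls (Add s t)),
     one = cls (Zero n k)\<rparr>"

definition presented :: "'g opterm set graded_operad"
  where "presented =
    \<lparr>component = presented_component,
     opunit = cls Unit,
     circ = (\<lambda>m k n l i A B. \<Union>s\<in>A. \<Union>t\<in>B. cls (Comp i s t))\<rparr>"


lemma deg_pos: "wft t \<Longrightarrow> 1 \<le> deg t"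
  by (induction t) auto

lemma eqv_invariant: "s \<doteq> t \<Longrightarrow> wft s \<and> wft t \<and> deg s = deg t \<and> wt s = wt t"
  by (induction rule: eqv.induct) (use deg_pos in \<open>force simp: sgn_term_def\<close>)+

lemma cls_eq_iff: "wft s \<Longrightarrow> cls s = cls t \<longleftrightarrow> s \<doteq> t"
  unfolding cls_def set_eq_iff mem_Collect_eq by (metis eqv.refl eqv.sym eqv.trans)

lemma cls_self: "wft t \<Longrightarrow> t \<in> cls t"
  by (simp add: cls_def eqv.refl)

lemma mult_cls:
  assumes "wft (Add s t)"
  shows "cls s \<otimes>\<^bsub>presented_component n k\<^esub> cls t = cls (Add s t)"
proof -
  have eq: "cls (Add s' t') = cls (Add s t)" if "s' \<in> cls s" "t' \<in> cls t" for s' t'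
  proof -
    have "s \<doteq> s'" "t \<doteq> t'" using that by (simp_all add: cls_def)
    then have "Add s t \<doteq> Add s' t'" using assms by (rule eqv.cong_Add)
    then show ?thesis using cls_eq_iff[OF assms] by blast
  qed
  have "s \<in> cls s" "t \<in> cls t" using assms by (simp_all add: cls_self)
  then have "(\<Union>s'\<in>cls s. \<Union>t'\<in>cls t. cls (Add s' t')) = cls (Add s t)"
    using eq by blast
  then show ?thesis by (simp add: presented_component_def)
qed

lemma circ_cls:
  assumes "wft (Comp i s t)"
  shows "circ presented m k n l i (cls s) (cls t) = cls (Comp i s t)"
proof -
  have eq: "cls (Comp i s' t') = cls (Comp i s t)" if "s' \<in> cls s" "t' \<in> cls t" for s' t'
  proof -
    have "s \<doteq> s'" "t \<doteq> t'" using that by (simp_all add: cls_def)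
    then have "Comp i s t \<doteq> Comp i s' t'" using assms by (rule eqv.cong_Comp)
    then show ?thesis using cls_eq_iff[OF assms] by blast
  qed
  have "s \<in> cls s" "t \<in> cls t" using assms by (simp_all add: cls_self)
  then have "(\<Union>s'\<in>cls s. \<Union>t'\<in>cls t. cls (Comp i s' t')) = cls (Comp i s t)"
    using eq by blast
  then show ?thesis by (simp add: presented_def)
qed

lemma carrier_presented:
  "carrier (presented_component n k) = cls ` {t. wft t \<and> deg t = n \<and> wt t = k}"
  by (simp add: presented_component_def)

lemma one_presented: "\<one>\<^bsub>presented_component n k\<^esub> = cls (Zero n k)"
  by (simp add: presented_component_def)

lemma comm_group_presented: "1 \<le> n \<Longrightarrow> comm_group (presented_component n k)"
proof (rule comm_groupI)
  assume n: "1 \<le> n"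
  let ?G = "presented_component n k"
  show "\<one>\<^bsub>?G\<^esub> \<in> carrier ?G"
    using n by (auto simp: one_presented carrier_presented)
  fix A assume "A \<in> carrier ?G"
  then obtain s where s: "A = cls s" "wft s" "deg s = n" "wt s = k"
    by (auto simp: carrier_presented)
  show "\<one>\<^bsub>?G\<^esub> \<otimes>\<^bsub>?G\<^esub> A = A"
    using s n eqv.Add_Zero[of s] by (simp add: one_presented mult_cls cls_eq_iff)
  show "\<exists>B\<in>carrier ?G. B \<otimes>\<^bsub>?G\<^esub> A = \<one>\<^bsub>?G\<^esub>"
  proof
    show "cls (Neg s) \<otimes>\<^bsub>?G\<^esub> A = \<one>\<^bsub>?G\<^esub>"
      using s eqv.Add_Neg[of s] by (simp add: one_presented mult_cls cls_eq_iff)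
    show "cls (Neg s) \<in> carrier ?G" using s by (auto simp: carrier_presented)
  qed
  fix B assume "B \<in> carrier ?G"
  then obtain t where t: "B = cls t" "wft t" "deg t = n" "wt t = k"
    by (auto simp: carrier_presented)
  show "A \<otimes>\<^bsub>?G\<^esub> B \<in> carrier ?G"
    using s t by (auto simp: mult_cls carrier_presented)
  show "A \<otimes>\<^bsub>?G\<^esub> B = B \<otimes>\<^bsub>?G\<^esub> A"
    using s t eqv.Add_commute[of s t] by (simp add: mult_cls cls_eq_iff)
  fix C assume "C \<in> carrier ?G"
  then obtain u where u: "C = cls u" "wft u" "deg u = n" "wt u = k"
    by (auto simp: carrier_presented)
  show "A \<otimes>\<^bsub>?G\<^esub> B \<otimes>\<^bsub>?G\<^esub> C = A \<otimes>\<^bsub>?G\<^esub> (B \<otimes>\<^bsub>?G\<^esub> C)"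
    using s t u eqv.Add_assoc[of s t u] by (simp add: mult_cls cls_eq_iff)
qed

lemma inv_cls:
  assumes "wft t" "deg t = n" "wt t = k"
  shows "inv\<^bsub>presented_component n k\<^esub> (cls t) = cls (Neg t)"
proof -
  interpret comm_group "presented_component n k"
    using comm_group_presented assms deg_pos by blast
  have "cls (Neg t) \<otimes>\<^bsub>presented_component n k\<^esub> cls t = \<one>\<^bsub>presented_component n k\<^esub>"
    using assms eqv.Add_Neg[of t] by (simp add: one_presented mult_cls cls_eq_iff)
  moreover have "cls t \<in> carrier (presented_component n k)"
    "cls (Neg t) \<in> carrier (presented_component n k)"
    using assms by (auto simp: carrier_presented)
  ultimately show ?thesis by (simp add: inv_equality)
qed

lemma signed_cls:
  assumes "wft t" "deg t = n" "wt t = k"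
  shows "signed (presented_component n k) l (cls t) = cls (sgn_term l t)"
  using assms by (simp add: signed_def sgn_term_def inv_cls)

lemma component_presented [simp]: "component presented = presented_component"
  by (simp add: presented_def)

lemma opunit_presented [simp]: "opunit presented = cls Unit"
  by (simp add: presented_def)

lemma wft_sgn_term [simp]:
  "wft (sgn_term k t) = wft t" "deg (sgn_term k t) = deg t" "wt (sgn_term k t) = wt t"
  by (auto simp: sgn_term_def)

lemma in_presented_component:
  "A \<in> carrier (presented_component n k) \<longleftrightarrow> (\<exists>t. A = cls t \<and> wft t \<and> deg t = n \<and> wt t = k)"
  by (auto simp: carrier_presented)

theorem operad_presented: "operad presented"
proof (rule operad.intro)
  show "1 \<le> n \<Longrightarrow> comm_group (component presented n k)" for n k
    by (simp add: comm_group_presented)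
  show "opunit presented \<in> carrier (component presented 1 0)"
    by (auto simp: carrier_presented)
  fix i m n :: nat and k l :: int and A B
  assume i: "1 \<le> i" "i \<le> m" and n: "1 \<le> n"
    and "A \<in> carrier (component presented m k)" "B \<in> carrier (component presented n l)"
  then obtain s t where s: "A = cls s" "wft s" "deg s = m" "wt s = k"
    and t: "B = cls t" "wft t" "deg t = n" "wt t = l"
    by (auto simp: carrier_presented)
  show "circ presented m k n l i A B \<in> carrier (component presented (m + n - 1) (k + l))"
    using i s t by (auto simp: circ_cls in_presented_component intro!: exI[of _ "Comp i s t"])
  show "circ presented m k n l i (A \<otimes>\<^bsub>component presented m k\<^esub> A') B =
      circ presented m k n l i A B \<otimes>\<^bsub>component presented (m + n - 1) (k + l)\<^esub>
      circ presented m k n l i A' B"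
    if "A' \<in> carrier (component presented m k)" for A'
  proof -
    from that obtain s' where "A' = cls s'" "wft s'" "deg s' = m" "wt s' = k"
      by (auto simp: carrier_presented)
    then show ?thesis
      using i s t eqv.Comp_Add_left[of i s s' t] by (simp add: circ_cls mult_cls cls_eq_iff)
  qed
  show "circ presented m k n l i A (B \<otimes>\<^bsub>component presented n l\<^esub> B') =
      circ presented m k n l i A B \<otimes>\<^bsub>component presented (m + n - 1) (k + l)\<^esub>
      circ presented m k n l i A B'"
    if "B' \<in> carrier (component presented n l)" for B'
  proof -
    from that obtain s' where "B' = cls s'" "wft s'" "deg s' = n" "wt s' = l"
      by (auto simp: carrier_presented)
    then show ?thesis
      using i s t eqv.Comp_Add_right[of i s t s'] by (simp add: circ_cls mult_cls cls_eq_iff)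
  qed
next
  fix n :: nat and l :: int and B
  assume "B \<in> carrier (component presented n l)"
  then obtain t where t: "B = cls t" "wft t" "deg t = n" "wt t = l"
    by (auto simp: carrier_presented)
  then show "circ presented 1 0 n l 1 (opunit presented) B = B"
    using circ_cls[of 1 Unit t] eqv.Unit_left[of t] by (simp add: cls_eq_iff)
next
  fix i m :: nat and k :: int and A
  assume i: "1 \<le> i" "i \<le> m" and "A \<in> carrier (component presented m k)"
  then obtain s where s: "A = cls s" "wft s" "deg s = m" "wt s = k"
    by (auto simp: carrier_presented)
  then show "circ presented m k 1 0 i A (opunit presented) = A"
    using i circ_cls[of i s Unit] eqv.Unit_right[of i s] by (simp add: cls_eq_iff)
next
  fix i m j n p :: nat and k l q :: int and A B C
  assume *: "1 \<le> i" "i \<le> m" "1 \<le> j" "j \<le> n" "1 \<le> p"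
    and "A \<in> carrier (component presented m k)" "B \<in> carrier (component presented n l)"
      "C \<in> carrier (component presented p q)"
  then obtain s t u where "A = cls s" "wft s" "deg s = m" "wt s = k"
    and "B = cls t" "wft t" "deg t = n" "wt t = l"
    and "C = cls u" "wft u" "deg u = p" "wt u = q"
    by (auto simp: carrier_presented)
  note x = this
  have w: "wft (Comp i s t)" "wft (Comp j t u)" "wft (Comp (j + i - 1) (Comp i s t) u)"
    "wft (Comp i s (Comp j t u))"
    using * x by auto
  show "circ presented (m + n - 1) (k + l) p q (j + i - 1) (circ presented m k n l i A B) C =
      circ presented m k (n + p - 1) (l + q) i A (circ presented n l p q j B C)"
    unfolding x(1,5,9) circ_cls[OF w(1)] circ_cls[OF w(2)] circ_cls[OF w(3)] circ_cls[OF w(4)]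
    using * x w eqv.Comp_nested[of s t u i j] by (simp add: cls_eq_iff)
next
  fix i j m n p :: nat and k l q :: int and A B C
  assume *: "1 \<le> i" "i < j" "j \<le> m" "1 \<le> n" "1 \<le> p"
    and "A \<in> carrier (component presented m k)" "B \<in> carrier (component presented n l)"
      "C \<in> carrier (component presented p q)"
  then obtain s t u where x: "A = cls s" "wft s" "deg s = m" "wt s = k"
     "B = cls t" "wft t" "deg t = n" "wt t = l"
     "C = cls u" "wft u" "deg u = p" "wt u = q"
    by (auto simp: carrier_presented)
  have eq: "signed (component presented (m + n + p - 2) (k + l + q)) (l * q)
        (circ presented (m + p - 1) (k + q) n l i (circ presented m k p q j A C) B)
      = cls (sgn_term (l * q) (Comp i (Comp j s u) t))"
    using * x by (simp add: circ_cls signed_cls)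
  show "circ presented (m + n - 1) (k + l) p q (j + n - 1) (circ presented m k n l i A B) C =
      signed (component presented (m + n + p - 2) (k + l + q)) (l * q)
        (circ presented (m + p - 1) (k + q) n l i (circ presented m k p q j A C) B)"
  proof -
    have w: "wft (Comp i s t)" "wft (Comp (j + n - 1) (Comp i s t) u)"
      using * x by auto
    have "cls (Comp (j + n - 1) (Comp i s t) u) = cls (sgn_term (l * q) (Comp i (Comp j s u) t))"
      using * x w eqv.Comp_parallel[of s t u i j] by (simp add: cls_eq_iff)
    then have "circ presented (m + n - 1) (k + l) p q (j + n - 1) (circ presented m k n l i A B) C =
        cls (sgn_term (l * q) (Comp i (Comp j s u) t))"
      unfolding x(1,5,9) circ_cls[OF w(1)] circ_cls[OF w(2)] .
    then show ?thesis using eq by (simp only:)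
  qed
qed

primrec interp :: "('a, 'c) graded_operad_scheme \<Rightarrow> ('g \<Rightarrow> 'a) \<Rightarrow> 'g opterm \<Rightarrow> 'a" where
  "interp P \<gamma> Unit = opunit P"
| "interp P \<gamma> (Gen x) = \<gamma> x"
| "interp P \<gamma> (Zero n k) = \<one>\<^bsub>component P n k\<^esub>"
| "interp P \<gamma> (Neg t) = inv\<^bsub>component P (deg t) (wt t)\<^esub> (interp P \<gamma> t)"
| "interp P \<gamma> (Add s t) = interp P \<gamma> s \<otimes>\<^bsub>component P (deg s) (wt s)\<^esub> interp P \<gamma> t"
| "interp P \<gamma> (Comp i s t) = circ P (deg s) (wt s) (deg t) (wt t) i (interp P \<gamma> s) (interp P \<gamma> t)"

lemma interp_closed:
  assumes "operad P" and "\<And>x. 1 \<le> dg x \<Longrightarrow> \<gamma> x \<in> carrier (component P (dg x) (wg x))"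
  shows "wft t \<Longrightarrow> interp P \<gamma> t \<in> carrier (component P (deg t) (wt t))"
proof (induction t)
  interpret operad P by fact
  case Unit then show ?case using unit_closed by simp
next
  case (Gen x) then show ?case using assms(2) by simp
next
  interpret operad P by fact
  case (Zero n k)
  then interpret comm_group "component P n k" using comm_group_component by simp
  show ?case by simp
next
  interpret operad P by fact
  case (Neg t)
  then interpret comm_group "component P (deg t) (wt t)"
    using comm_group_component deg_pos by simp
  show ?case using Neg by simp
next
  interpret operad P by fact
  case (Add s t)
  then interpret comm_group "component P (deg t) (wt t)"
    using comm_group_component deg_pos by simp
  show ?case using Add by simp
next
  interpret operad P by fact
  case (Comp i s t) then show ?case using circ_closed deg_pos by simp
qed

lemma interp_eqv:
  assumes P: "operad P" and \<gamma>: "\<And>x. 1 \<le> dg x \<Longrightarrow> \<gamma> x \<in> carrier (component P (dg x) (wg x))"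
    and R: "\<And>r. r \<in> R \<Longrightarrow> wft r \<Longrightarrow> interp P \<gamma> r = \<one>\<^bsub>component P (deg r) (wt r)\<^esub>"
  shows "s \<doteq> t \<Longrightarrow> interp P \<gamma> s = interp P \<gamma> t"
proof (induction rule: eqv.induct)
  note closed = interp_closed[OF P \<gamma>]
  interpret operad P by fact
  have G: "comm_group (component P (deg t) (wt t))" if "wft t" for t
    using comm_group_component deg_pos that by blast
  {
    case (cong_Add s s' t t') then show ?case
      using eqv_invariant[of s s'] eqv_invariant[of t t'] by simp
  next
    case (cong_Comp s s' t t' i) then show ?case
      using eqv_invariant[of s s'] eqv_invariant[of t t'] by simp
  next
    case (cong_Neg s t) then show ?case
      using eqv_invariant[of s t] by simp
  next
    case (Add_assoc s t u)
    then interpret comm_group "component P (deg s) (wt s)" using G by simp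
    have "interp P \<gamma> s \<in> carrier (component P (deg s) (wt s))"
      "interp P \<gamma> t \<in> carrier (component P (deg s) (wt s))"
      "interp P \<gamma> u \<in> carrier (component P (deg s) (wt s))"
      using Add_assoc closed[of s] closed[of t] closed[of u]
      by (metis wft.simps(5) deg.simps(5) wt.simps(5))+
    from m_assoc[OF this] show ?case using Add_assoc by simp
  next
    case (Add_commute s t)
    then interpret comm_group "component P (deg t) (wt t)" using G by simp
    show ?case using Add_commute closed[of s] closed[of t] by (simp add: m_comm)
  next
    case (Add_Zero t)
    then interpret comm_group "component P (deg t) (wt t)" using G by simp
    show ?case using Add_Zero closed[of t] by simp
  next
    case (Add_Neg t)
    then interpret comm_group "component P (deg t) (wt t)" using G by simp
    show ?case using Add_Neg closed[of t] by simp
  next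
    case (Comp_Add_left i s s' t) then show ?case
      using circ_add_left[of i "deg s" "deg t"] deg_pos[of t] closed[of s] closed[of s'] closed[of t]
      by simp
  next
    case (Comp_Add_right i s t t') then show ?case
      using circ_add_right[of i "deg s" "deg t"] deg_pos[of t] closed[of s] closed[of t] closed[of t']
      by simp
  next
    case (Unit_left t) then show ?case
      using unit_left deg_pos[of t] closed[of t] by simp
  next
    case (Unit_right i t) then show ?case
      using unit_right closed[of t] by simp
  next
    case (Comp_nested s t u i j) then show ?case
      using circ_nested[of i "deg s" j "deg t" "deg u"] deg_pos[of u]
        closed[of s] closed[of t] closed[of u] by simp
  next
    case (Comp_parallel s t u i j) 
    let ?X = "circ P (deg s + deg u - 1) (wt s + wt u) (deg t) (wt t) i
      (circ P (deg s) (wt s) (deg u) (wt u) j (interp P \<gamma> s) (interp P \<gamma> u)) (interp P \<gamma> t)"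
    have "deg s + deg t + deg u - 2 = deg s + deg u - 1 + deg t - 1"
      using deg_pos[of u] deg_pos[of t] Comp_parallel by simp
    moreover have "wt s + wt t + wt u = wt s + wt u + wt t" by simp
    ultimately have eq: "component P (deg s + deg t + deg u - 2) (wt s + wt t + wt u) =
        component P (deg s + deg u - 1 + deg t - 1) (wt s + wt u + wt t)"
      by (simp only:)
    have "interp P \<gamma> (Comp (j + deg t - 1) (Comp i s t) u) =
        signed (component P (deg s + deg t + deg u - 2) (wt s + wt t + wt u)) (wt t * wt u) ?X"
      using circ_parallel[of i j "deg s" "deg t" "deg u"] deg_pos[of u] deg_pos[of t]
        closed[of s] closed[of t] closed[of u] Comp_parallel by simp
    also have "\<dots> = interp P \<gamma> (sgn_term (wt t * wt u) (Comp i (Comp j s u) t))"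
      by (simp only: eq) (simp add: sgn_term_def signed_def)
    finally show ?case .
  next
    case (relator r) then show ?case using R by simp
  }
qed auto

theorem presented_universal:
  assumes P: "operad P" and \<gamma>: "\<And>x. 1 \<le> dg x \<Longrightarrow> \<gamma> x \<in> carrier (component P (dg x) (wg x))"
    and R: "\<And>r. r \<in> R \<Longrightarrow> wft r \<Longrightarrow> interp P \<gamma> r = \<one>\<^bsub>component P (deg r) (wt r)\<^esub>"
  shows "\<exists>\<phi>. operad_hom presented P \<phi> \<and> (\<forall>x. 1 \<le> dg x \<longrightarrow> \<phi> (dg x) (wg x) (cls (Gen x)) = \<gamma> x)"
proof -
  define \<phi> where "\<phi> n k A = interp P \<gamma> (SOME t. t \<in> A)" for n :: nat and k :: int and A
  have \<phi>: "\<phi> n k (cls t) = interp P \<gamma> t" if "wft t" for n k t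
  proof -
    have "(SOME s. s \<in> cls t) \<in> cls t" using cls_self[OF that] by (rule someI)
    then show ?thesis using interp_eqv[OF P \<gamma> R] by (simp add: cls_def \<phi>_def)
  qed
  have "operad_hom presented P \<phi>"
    unfolding operad_hom_def
  proof (intro conjI allI impI)
    show "\<phi> n k \<in> hom (component presented n k) (component P n k)" for n k
      using interp_closed[OF P \<gamma>] by (auto simp: hom_def carrier_presented \<phi> mult_cls)
    show "\<phi> 1 0 (opunit presented) = opunit P" by (simp add: \<phi>)
    show "\<phi> (m + n - 1) (k + l) (circ presented m k n l i A B) =
        circ P m k n l i (\<phi> m k A) (\<phi> n l B)"
      if "1 \<le> i" "i \<le> m" "A \<in> carrier (component presented m k)"
        "B \<in> carrier (component presented n l)" for i m n k l A B
      using that by (auto simp: carrier_presented \<phi> circ_cls)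
  qed
  then show ?thesis by (auto simp: \<phi>)
qed

theorem presented_universal_unique:
  assumes P: "operad P" and \<phi>: "operad_hom presented P \<phi>" and \<psi>: "operad_hom presented P \<psi>"
    and eq: "\<And>x. 1 \<le> dg x \<Longrightarrow> \<phi> (dg x) (wg x) (cls (Gen x)) = \<psi> (dg x) (wg x) (cls (Gen x))"
    and A: "A \<in> carrier (component presented n k)" "1 \<le> n"
  shows "\<phi> n k A = \<psi> n k A"
proof -
  interpret operad P by fact
  have "\<theta> (deg t) (wt t) (cls t) = interp P (\<lambda>x. \<theta> (dg x) (wg x) (cls (Gen x))) t"
    if \<theta>: "operad_hom presented P \<theta>" and t: "wft t" for \<theta> t
    using t
  proof (induction t)
    case Unit then show ?case using \<theta> by (simp add: operad_hom_def)
  next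
    case (Gen x) then show ?case by simp
  next
    case (Zero n k)
    then have "\<theta> n k \<in> hom (presented_component n k) (component P n k)"
      using \<theta> by (simp add: operad_hom_def)
    then have "\<theta> n k \<one>\<^bsub>presented_component n k\<^esub> = \<one>\<^bsub>component P n k\<^esub>"
      using Zero comm_group_component comm_group_presented
      by (intro hom_one) (auto simp: comm_group.axioms(2))
    then show ?case by (simp add: one_presented)
  next
    case (Neg t)
    let ?G = "presented_component (deg t) (wt t)" and ?H = "component P (deg t) (wt t)"
    have "1 \<le> deg t" using deg_pos Neg by simp
    then have "group_hom ?G ?H (\<theta> (deg t) (wt t))"
      using \<theta> comm_group_component comm_group_presented
      by (auto simp: operad_hom_def group_hom_def group_hom_axioms_def comm_group.axioms(2))
    moreover have "cls t \<in> carrier ?G" using Neg by (auto simp: carrier_presented)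
    ultimately have "\<theta> (deg t) (wt t) (inv\<^bsub>?G\<^esub> cls t) = inv\<^bsub>?H\<^esub> \<theta> (deg t) (wt t) (cls t)"
      by (rule group_hom.hom_inv)
    then show ?case using Neg by (simp add: inv_cls)
  next
    case (Add s t)
    let ?G = "presented_component (deg s) (wt s)"
    have "1 \<le> deg s" using deg_pos Add by simp
    then have "\<theta> (deg s) (wt s) \<in> hom ?G (component P (deg s) (wt s))"
      using \<theta> by (simp add: operad_hom_def)
    moreover have "cls s \<in> carrier ?G" "cls t \<in> carrier ?G"
      using Add by (auto simp: carrier_presented)
    ultimately have "\<theta> (deg s) (wt s) (cls s \<otimes>\<^bsub>?G\<^esub> cls t) =
        \<theta> (deg s) (wt s) (cls s) \<otimes>\<^bsub>component P (deg s) (wt s)\<^esub> \<theta> (deg s) (wt s) (cls t)"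
      by (rule hom_mult)
    then show ?case using Add by (simp add: mult_cls)
  next
    case (Comp i s t)
    have "cls s \<in> carrier (component presented (deg s) (wt s))"
      "cls t \<in> carrier (component presented (deg t) (wt t))"
      using Comp by (auto simp: carrier_presented)
    then have "\<theta> (deg s + deg t - 1) (wt s + wt t)
          (circ presented (deg s) (wt s) (deg t) (wt t) i (cls s) (cls t)) =
        circ P (deg s) (wt s) (deg t) (wt t) i (\<theta> (deg s) (wt s) (cls s)) (\<theta> (deg t) (wt t) (cls t))"
      using \<theta> Comp.prems deg_pos[of t] unfolding operad_hom_def by simp
    then show ?case using Comp by (simp add: circ_cls)
  qed
  note val = this
  have gen: "interp P (\<lambda>x. \<phi> (dg x) (wg x) (cls (Gen x))) t =
      interp P (\<lambda>x. \<psi> (dg x) (wg x) (cls (Gen x))) t" if "wft t" for t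
    using that by (induction t) (auto simp: eq)
  obtain t where t: "A = cls t" "wft t" "deg t = n" "wt t = k"
    using A by (auto simp: carrier_presented)
  show ?thesis
    using val[OF \<phi> t(2)] val[OF \<psi> t(2)] gen[OF t(2)] unfolding t(1,3,4) by metis
qed

end


section \<open>The operad \<open>\<^bold>V\<close>\<close>

definition V_relator :: "unit opterm"
  where "V_relator =
    (let g = Gen () in Add (Add (Comp 1 g g) (Neg (Comp 2 g g))) (Comp 3 g g))"

interpretation Vp: operad_presentation "\<lambda>_. 3" "\<lambda>_. 1" "{V_relator}" .

definition V :: "unit opterm set graded_operad"
  where "V = operad_presentation.presented (\<lambda>_. 3) (\<lambda>_. 1) {V_relator}"

definition V_gen :: "unit opterm set"
  where "V_gen = operad_presentation.cls (\<lambda>_. 3) (\<lambda>_. 1) {V_relator} (Gen ())"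

lemma operad_V: "operad V"
  unfolding V_def by (rule Vp.operad_presented)

interpretation V: operad V by (rule operad_V)

lemma V_gen_closed: "V_gen \<in> carrier (component V 3 1)"
  by (auto simp: V_def V_gen_def Vp.carrier_presented)

lemma V_relation:
  "(circ V 3 1 3 1 1 V_gen V_gen \<otimes>\<^bsub>component V 5 2\<^esub>
    inv\<^bsub>component V 5 2\<^esub> (circ V 3 1 3 1 2 V_gen V_gen)) \<otimes>\<^bsub>component V 5 2\<^esub>
    circ V 3 1 3 1 3 V_gen V_gen = \<one>\<^bsub>component V 5 2\<^esub>"
proof -
  have "Vp.eqv V_relator (Zero 5 2)"
    using Vp.eqv.relator[of V_relator] by (simp add: V_relator_def Let_def)
  then have rel: "Vp.cls V_relator = Vp.cls (Zero 5 2)"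
    using Vp.eqv_invariant Vp.cls_eq_iff by blast
  have "Vp.cls (Add (Add (Comp 1 (Gen ()) (Gen ())) (Neg (Comp 2 (Gen ()) (Gen ()))))
      (Comp 3 (Gen ()) (Gen ()))) = Vp.cls V_relator"
    by (simp add: V_relator_def Let_def)
  then show ?thesis
    by (simp add: V_def V_gen_def Vp.circ_cls Vp.inv_cls Vp.mult_cls Vp.one_presented rel)
qed


section \<open>Planar binary trees and the elements \<open>Q\<^sub>x\<close>\<close>

datatype pbtree = Triv | Join pbtree pbtree

primrec vertices :: "pbtree \<Rightarrow> nat" where
  "vertices Triv = 0"
| "vertices (Join x y) = vertices x + vertices y + 1"

definition Y :: "nat \<Rightarrow> pbtree set"
  where "Y n = {x. vertices x = n}"

text \<open>\<open>Q x\<close> has degree \<open>2 * vertices x + 1\<close> and weight \<open>vertices x\<close>. The second of the two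
  equivalent recursive formulas is taken as the definition; the first is lemma \<open>Q_Join'\<close>.\<close>

primrec Q :: "pbtree \<Rightarrow> unit opterm set" where
  "Q Triv = opunit V"
| "Q (Join x y) =
    (let m = vertices x; n = vertices y in
      signed (component V (2 * (m + n + 1) + 1) (int (m + n + 1))) (int m)
        (circ V (2 * m + 3) (int m + 1) (2 * n + 1) (int n) (2 * m + 3)
          (circ V 3 1 (2 * m + 1) (int m) 1 V_gen (Q x))
          (Q y)))"

lemma V_signed_closed:
  "a \<in> carrier (component V n k) \<Longrightarrow> 1 \<le> n \<Longrightarrow> signed (component V n k) l a \<in> carrier (component V n k)"
  by (simp add: signed_def V.comm_group_component comm_group.axioms(2) group.inv_closed)

lemma Q_closed: "Q x \<in> carrier (component V (2 * vertices x + 1) (int (vertices x)))"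
proof (induction x)
  case Triv then show ?case using V.unit_closed by simp
next
  case (Join x y)
  let ?m = "vertices x" and ?n = "vertices y"
  have "circ V 3 1 (2 * ?m + 1) (int ?m) 1 V_gen (Q x) \<in> carrier (component V (2 * ?m + 3) (int ?m + 1))"
    using V.circ_closed[OF _ _ _ V_gen_closed Join.IH(1), of 1] by (simp add: algebra_simps)
  from V.circ_closed[OF _ _ _ this Join.IH(2), of "2 * ?m + 3"]
  have "circ V (2 * ?m + 3) (int ?m + 1) (2 * ?n + 1) (int ?n) (2 * ?m + 3)
      (circ V 3 1 (2 * ?m + 1) (int ?m) 1 V_gen (Q x)) (Q y)
    \<in> carrier (component V (2 * ?m + 3 + (2 * ?n + 1) - 1) (int ?m + 1 + int ?n))"
    by simp
  moreover have "2 * ?m + 3 + (2 * ?n + 1) - 1 = 2 * (?m + ?n + 1) + 1"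
    "int ?m + 1 + int ?n = int (?m + ?n + 1)" by simp_all
  ultimately show ?case by (simp only: Q.simps vertices.simps Let_def V_signed_closed le_add2)
qed

lemma Q_Join':
  "Q (Join x y) =
    (let m = vertices x; n = vertices y in
      signed (component V (2 * (m + n + 1) + 1) (int (m + n + 1))) (int m + int m * int n)
        (circ V (2 * n + 3) (int n + 1) (2 * m + 1) (int m) 1
          (circ V 3 1 (2 * n + 1) (int n) 3 V_gen (Q y))
          (Q x)))"
proof -
  let ?m = "vertices x" and ?n = "vertices y"
  let ?G = "component V (2 * (?m + ?n + 1) + 1) (int (?m + ?n + 1))"
  let ?B = "circ V (2 * ?n + 3) (int ?n + 1) (2 * ?m + 1) (int ?m) 1
          (circ V 3 1 (2 * ?n + 1) (int ?n) 3 V_gen (Q y)) (Q x)"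
  have c: "circ V 3 1 (2 * ?n + 1) (int ?n) 3 V_gen (Q y) \<in> carrier (component V (2 * ?n + 3) (int ?n + 1))"
    using V.circ_closed[OF _ _ _ V_gen_closed Q_closed, of 3 y] by (simp add: algebra_simps)
  have B: "?B \<in> carrier ?G"
  proof -
    have "?B \<in> carrier (component V (2 * ?n + 3 + (2 * ?m + 1) - 1) (int ?n + 1 + int ?m))"
      using V.circ_closed[OF _ _ _ c Q_closed, of 1 x] by simp
    moreover have "2 * ?n + 3 + (2 * ?m + 1) - 1 = 2 * (?m + ?n + 1) + 1"
      "int ?n + 1 + int ?m = int (?m + ?n + 1)" by simp_all
    ultimately show ?thesis by (simp only:)
  qed
  interpret G: comm_group ?G by (simp add: V.comm_group_component)
  have "circ V (2 * ?m + 3) (int ?m + 1) (2 * ?n + 1) (int ?n) (2 * ?m + 3)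
          (circ V 3 1 (2 * ?m + 1) (int ?m) 1 V_gen (Q x)) (Q y) = signed ?G (int ?m * int ?n) ?B"
    using V.circ_parallel[OF _ _ _ _ _ V_gen_closed Q_closed Q_closed, of 1 3 x y]
    by (simp add: algebra_simps numeral_3_eq_3)
  then show ?thesis using G.signed_signed[OF B] by (simp only: Q.simps Let_def)
qed


section \<open>Bases of abelian groups\<close>

definition abelian_basis :: "('a, 'c) monoid_scheme \<Rightarrow> 'i set \<Rightarrow> ('i \<Rightarrow> 'a) \<Rightarrow> bool"
  where "abelian_basis G I b \<longleftrightarrow>
    comm_group G \<and> b \<in> I \<rightarrow> carrier G \<and>
    (\<forall>v\<in>carrier G. \<exists>!c. c \<in> carrier (free_Abelian_group I) \<and>
      v = (\<Otimes>\<^bsub>G\<^esub>x\<in>Poly_Mapping.keys c. b x [^]\<^bsub>G\<^esub> Poly_Mapping.lookup c x))"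

end

theory Submission
  imports Defs
begin

text \<open>
  The relation rewrites \<open>g \<circ>\<^sub>2 g\<close> as \<open>g \<circ>\<^sub>1 g + g \<circ>\<^sub>3 g\<close>, so whatever is plugged into the middle input
  of \<open>g\<close> can be pushed to the two sides until the middle input is trivial; induction on the
  middle argument shows that the span of the \<open>Q\<^sub>x\<close> is closed under all compositions.

  Conversely, the same rewriting rule defines, by recursion on its middle argument, a ternary operation
  of weight 1 on the free abelian group on all planar binary trees, where a tree has its number of
  vertices as weight. The critical pair \<open>g \<circ>\<^sub>2 (g \<circ>\<^sub>2 g)\<close> is confluent, hence this operation
  satisfies the relation for all arguments and \<open>\<^bold>V\<close> acts on the group, which is the free
  \<open>\<^bold>V\<close>-algebra on the trivial tree. As \<open>Q\<^sub>x\<close> takes \<open>(|, \<dots>, |)\<close> to \<open>\<plusminus>x\<close>, the \<open>Q\<^sub>x\<close> are independent.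
\<close>

section \<open>Free abelian groups\<close>

text \<open>A homomorphism out of the free abelian group is determined on generators, so
  \<open>h c\<close> is the product in the definition of a basis. Surjectivity of \<open>h\<close>
  then gives existence of the coefficients, injectivity their uniqueness.\<close>

lemma abelian_basisI:
  assumes G: "comm_group G" and h: "h \<in> iso (free_Abelian_group I) G"
    and b: "\<And>x. x \<in> I \<Longrightarrow> h (frag_of x) = b x"
  shows "abelian_basis G I b"
proof -
  interpret comm_group G by (rule G)
  let ?F = "free_Abelian_group I"
  interpret F: comm_group ?F by (rule abelian_free_Abelian_group)
  have hom: "h \<in> hom ?F G" and bij: "bij_betw h (carrier ?F) (carrier G)"
    using h by (auto simp: iso_def)
  have bI: "b x \<in> carrier G" if "x \<in> I" for x
    using hom_in_carrier[OF hom, of "frag_of x"] b[OF that] that by simp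
  \<comment> \<open>The coefficients \<open>k\<close> are decoupled from \<open>A\<close>, so that
    the induction on \<open>A\<close> leaves them alone; the case of interest takes for
    \<open>A\<close> the support of \<open>c\<close>.\<close>
  have *: "h (\<Sum>i\<in>A. frag_cmul (k i) (frag_of i)) = (\<Otimes>\<^bsub>G\<^esub>i\<in>A. b i [^]\<^bsub>G\<^esub> k i)"
    if "finite A" "A \<subseteq> I" for A and k :: "_ \<Rightarrow> int"
    using that
  proof (induction A)
    case empty
    then show ?case using hom_one[OF hom F.is_group is_group] by simp
  next
    case (insert i A)
    have "h (frag_cmul (k i) (frag_of i)) = h (frag_of i [^]\<^bsub>?F\<^esub> k i)"
      using insert.prems by simp
    also have "\<dots> = b i [^]\<^bsub>G\<^esub> k i"
      using insert.prems b hom_int_pow[OF hom _ F.is_group is_group] by simp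
    finally have i: "h (frag_cmul (k i) (frag_of i)) = b i [^]\<^bsub>G\<^esub> k i" .
    have "(\<Sum>i\<in>A. frag_cmul (k i) (frag_of i)) \<in> carrier ?F"
      using insert by (intro sum_closed_free_Abelian_group) (auto split: if_splits)
    moreover have "frag_cmul (k i) (frag_of i) \<in> carrier ?F"
      using insert.prems by auto
    ultimately have "h (frag_cmul (k i) (frag_of i) + (\<Sum>i\<in>A. frag_cmul (k i) (frag_of i))) =
        b i [^]\<^bsub>G\<^esub> k i \<otimes>\<^bsub>G\<^esub> h (\<Sum>i\<in>A. frag_cmul (k i) (frag_of i))"
      using hom_mult[OF hom] i by fastforce
    then show ?case using insert bI by (simp add: Pi_iff subset_iff)
  qed
  have h_eq: "h c = (\<Otimes>\<^bsub>G\<^esub>x\<in>Poly_Mapping.keys c. b x [^]\<^bsub>G\<^esub> Poly_Mapping.lookup c x)"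
    if "c \<in> carrier ?F" for c
    using *[of "Poly_Mapping.keys c" "Poly_Mapping.lookup c"] that frag_expansion[of c]
    by (simp add: frag_extend_def)
  show ?thesis
    unfolding abelian_basis_def
  proof (intro conjI ballI)
    show "b \<in> I \<rightarrow> carrier G" using bI by blast
    fix v assume v: "v \<in> carrier G"
    then have "v \<in> h ` carrier ?F" using bij unfolding bij_betw_def by blast
    then obtain c where c: "c \<in> carrier ?F" "v = h c" by blast
    show "\<exists>!c. c \<in> carrier ?F \<and> v = (\<Otimes>\<^bsub>G\<^esub>x\<in>Poly_Mapping.keys c. b x [^]\<^bsub>G\<^esub> Poly_Mapping.lookup c x)"
    proof (rule ex1I[of _ c])
      show "c \<in> carrier ?F \<and> v = (\<Otimes>\<^bsub>G\<^esub>x\<in>Poly_Mapping.keys c. b x [^]\<^bsub>G\<^esub> Poly_Mapping.lookup c x)"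
        using c h_eq by blast
      fix d assume "d \<in> carrier ?F \<and> v = (\<Otimes>\<^bsub>G\<^esub>x\<in>Poly_Mapping.keys d. b x [^]\<^bsub>G\<^esub> Poly_Mapping.lookup d x)"
      then have "d \<in> carrier ?F" "h d = h c" using c h_eq by auto
      then show "d = c" using bij c by (auto simp: bij_betw_def inj_on_def)
    qed
  qed (rule G)
qed

section \<open>Calculus of linear extension from a basis\<close>

lemma frag_cmul_diff_distrib2: "frag_cmul c (a - b) = frag_cmul c a - frag_cmul c b"
  by (rule poly_mapping_eqI) (simp add: lookup_minus algebra_simps)

lemma frag_extend_fun_diff:
  "frag_extend (\<lambda>x. f x - g x) c = frag_extend f c - frag_extend g c"
  by (simp add: frag_extend_def frag_cmul_diff_distrib2 sum_subtractf)

lemma frag_extend_fun_add: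
  "frag_extend (\<lambda>x. f x + g x) c = frag_extend f c + frag_extend g c"
  by (simp add: frag_extend_def frag_cmul_distrib2 sum.distrib)

lemma frag_extend_fun_cmul:
  "frag_extend (\<lambda>x. frag_cmul k (f x)) c = frag_cmul k (frag_extend f c)"
  by (simp add: frag_extend_def frag_cmul_sum mult.commute)

lemma frag_extend_fun_0: "frag_extend (\<lambda>x. 0) c = 0"
  by (simp add: frag_extend_def)

text \<open>Differences subsume sums and opposites, so identities between multilinear maps can be
  checked on basis elements, one argument at a time.\<close>

lemma frag_linear_induct [case_names zero one diff]:
  assumes "P 0" "\<And>x. P (frag_of x)" "\<And>a b. P a \<Longrightarrow> P b \<Longrightarrow> P (a - b)"
  shows "P c"
  by (rule frag_induction[of c UNIV]) (use assms in auto)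

lemma frag_extend_extend:
  "frag_extend f (frag_extend g c) = frag_extend (\<lambda>x. frag_extend f (g x)) c"
  by (induction c rule: frag_linear_induct) (simp_all add: frag_extend_diff)

lemma frag_extend_swap:
  "frag_extend (\<lambda>x. frag_extend (f x) d) c = frag_extend (\<lambda>y. frag_extend (\<lambda>x. f x y) c) d"
  by (induction c rule: frag_linear_induct)
    (simp_all add: frag_extend_diff frag_extend_fun_diff frag_extend_fun_0)

text \<open>Used as a congruence rule: it restricts \<open>x\<close> to the support, where the
  weight of a tree is known.\<close>

lemma frag_extend_eq_cong:
  "c = d \<Longrightarrow> (\<And>x. x \<in> Poly_Mapping.keys d \<Longrightarrow> f x = g x) \<Longrightarrow> frag_extend f c = frag_extend g d"
  by (simp add: frag_extend_def)

section \<open>The free \<open>\<^bold>V\<close>-algebra on one generator\<close>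

text \<open>Parity instead of a power of -1, because the weight of a formal expression may be
  negative.\<close>

definition psign :: "int \<Rightarrow> int" where "psign k = (if even k then 1 else -1)"

lemma psign_simps [simp]:
  "psign 0 = 1" "psign 1 = -1" "psign k * psign k = 1" "psign k * (psign k * c) = c"
  by (auto simp: psign_def)

lemma psign_add: "psign (j + k) = psign j * psign k"
  by (simp add: psign_def)

text \<open>
  The middle argument comes first. The signs are those of the relation evaluated at \<open>(x, u, |, v, y)\<close>,
  the Koszul rule contributing the weight of everything to the left of the inner operation.
\<close>

primrec graft :: "pbtree \<Rightarrow> pbtree \<Rightarrow> pbtree \<Rightarrow> (pbtree \<Rightarrow>\<^sub>0 int)" where
  "graft Triv = (\<lambda>x y. frag_of (Join x y))"
| "graft (Join u v) = (\<lambda>x y.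
     frag_cmul (psign (vertices x)) (frag_extend (\<lambda>w. graft v w y) (graft u x Triv)) +
     frag_cmul (psign (vertices u)) (frag_extend (\<lambda>w. graft u x w) (graft v Triv y)))"

text \<open>Homogeneity of weight 1: each summand of the recursion grafts twice, trading the root of
  \<open>Join u v\<close> for the second grafting.\<close>

lemma vertices_graft: "t \<in> Poly_Mapping.keys (graft w x y) \<Longrightarrow> vertices t = vertices x + vertices w + vertices y + 1"
proof (induction w arbitrary: x y t)
  case (Join u v)
  have ext: thesis if "t \<in> Poly_Mapping.keys (frag_cmul k (frag_extend f c))"
    "\<And>s. s \<in> Poly_Mapping.keys c \<Longrightarrow> t \<in> Poly_Mapping.keys (f s) \<Longrightarrow> thesis" for k f c thesis
    using that keys_frag_extend[of f c] by auto
  from Join.prems Poly_Mapping.keys_add consider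
    "t \<in> Poly_Mapping.keys (frag_cmul (psign (vertices x)) (frag_extend (\<lambda>w. graft v w y) (graft u x Triv)))"
  | "t \<in> Poly_Mapping.keys (frag_cmul (psign (vertices u)) (frag_extend (\<lambda>w. graft u x w) (graft v Triv y)))"
    by fastforce
  then show ?case by cases (erule ext; drule Join.IH; drule Join.IH; simp)+
qed simp

text \<open>The grading automorphism, \<open>(-1)^k\<close> in weight \<open>k\<close>. With signs
  carried by a linear map, the Koszul rule can be stated for arguments that are not
  homogeneous.\<close>

definition parity_sign :: "(pbtree \<Rightarrow>\<^sub>0 int) \<Rightarrow> (pbtree \<Rightarrow>\<^sub>0 int)"
  where "parity_sign = frag_extend (\<lambda>x. frag_cmul (psign (vertices x)) (frag_of x))"

text \<open>The trilinear operation by which \<open>g\<close> acts, with its arguments back in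
  planar order.\<close>

definition ternary :: "(pbtree \<Rightarrow>\<^sub>0 int) \<Rightarrow> (pbtree \<Rightarrow>\<^sub>0 int) \<Rightarrow> (pbtree \<Rightarrow>\<^sub>0 int) \<Rightarrow> (pbtree \<Rightarrow>\<^sub>0 int)"
  where "ternary x w y = frag_extend (\<lambda>a. frag_extend (\<lambda>b. frag_extend (\<lambda>c. graft b a c) y) w) x"

lemma ternary_linear:
  "ternary 0 w y = 0" "ternary x 0 y = 0" "ternary x w 0 = 0"
  "ternary (x + x') w y = ternary x w y + ternary x' w y"
  "ternary x (w + w') y = ternary x w y + ternary x w' y"
  "ternary x w (y + y') = ternary x w y + ternary x w y'"
  "ternary (x - x') w y = ternary x w y - ternary x' w y"
  "ternary x (w - w') y = ternary x w y - ternary x w' y"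
  "ternary x w (y - y') = ternary x w y - ternary x w y'"
  "ternary (- x) w y = - ternary x w y"
  "ternary x (- w) y = - ternary x w y"
  "ternary x w (- y) = - ternary x w y"
  "ternary (frag_cmul k x) w y = frag_cmul k (ternary x w y)"
  "ternary x (frag_cmul k w) y = frag_cmul k (ternary x w y)"
  "ternary x w (frag_cmul k y) = frag_cmul k (ternary x w y)"
  unfolding ternary_def frag_cmul_minus_one[symmetric]
  by (simp_all only: frag_extend_0 frag_extend_add frag_extend_diff frag_extend_cmul
     frag_extend_fun_add frag_extend_fun_diff frag_extend_fun_cmul frag_extend_fun_0)

lemma ternary_frag_of: "ternary (frag_of x) (frag_of w) (frag_of y) = graft w x y"
  by (simp add: ternary_def)

lemma parity_sign_linear:
  "parity_sign 0 = 0" "parity_sign (x + y) = parity_sign x + parity_sign y"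
  "parity_sign (x - y) = parity_sign x - parity_sign y" "parity_sign (- x) = - parity_sign x"
  "parity_sign (frag_cmul k x) = frag_cmul k (parity_sign x)"
  unfolding parity_sign_def
  by (simp_all add: frag_extend_add frag_extend_diff frag_extend_cmul frag_extend_minus)

lemma parity_sign_frag_of [simp]:
  "parity_sign (frag_of x) = frag_cmul (psign (vertices x)) (frag_of x)"
  by (simp add: parity_sign_def)

lemma parity_sign_parity_sign [simp]: "parity_sign (parity_sign x) = x"
  by (induction x rule: frag_linear_induct)
    (simp_all add: parity_sign_linear)

lemma parity_sign_homogeneous:
  assumes "\<And>x. x \<in> Poly_Mapping.keys c \<Longrightarrow> vertices x = n"
  shows "parity_sign c = frag_cmul (psign n) c"
proof -
  have "parity_sign c = frag_extend (\<lambda>x. frag_cmul (psign n) (frag_of x)) c"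
    unfolding parity_sign_def using assms by (intro frag_extend_eq) simp
  also have "\<dots> = frag_cmul (psign n) c"
    by (simp add: frag_extend_fun_cmul flip: frag_expansion)
  finally show ?thesis .
qed

text \<open>The operation has weight 1 and hence anticommutes with the grading automorphism.\<close>

lemma parity_sign_ternary:
  "parity_sign (ternary x w y) = - ternary (parity_sign x) (parity_sign w) (parity_sign y)"
proof (induction x rule: frag_linear_induct)
  case (one a)
  show ?case
  proof (induction w rule: frag_linear_induct)
    case (one b)
    show ?case
    proof (induction y rule: frag_linear_induct)
      case (one c)
      have "parity_sign (graft b a c) = frag_cmul (psign (int (vertices a + vertices b + vertices c + 1))) (graft b a c)"
        by (rule parity_sign_homogeneous) (rule vertices_graft)
      then show ?case by (simp add: ternary_linear ternary_frag_of psign_add mult_ac)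
    qed (simp_all add: ternary_linear parity_sign_linear flip: minus_frag_cmul)
  qed (simp_all add: ternary_linear parity_sign_linear flip: minus_frag_cmul)
qed (simp_all add: ternary_linear parity_sign_linear flip: minus_frag_cmul)

text \<open>The relation of the operad at \<open>(x, u, w, v, y)\<close>, multiplied by
  \<open>(-1)^x\<close>. Only the third of the five inputs is fixed, since the proof is an induction
  over that input.\<close>

definition relation_holds :: "(pbtree \<Rightarrow>\<^sub>0 int) \<Rightarrow> bool"
  where "relation_holds w \<longleftrightarrow> (\<forall>x u v y. ternary x (ternary u w v) y =
    ternary (ternary (parity_sign x) u w) v y + ternary x (parity_sign u) (ternary w v y))"

lemma relation_holds_linear: "relation_holds 0" "relation_holds p \<Longrightarrow> relation_holds q \<Longrightarrow> relation_holds (p - q)"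
  "relation_holds p \<Longrightarrow> relation_holds (- p)"
  by (simp_all add: relation_holds_def ternary_linear)

text \<open>On trees the equation is the second clause of \<open>graft\<close>, because
  \<open>graft Triv u v\<close> is the tree \<open>Join u v\<close>; multilinearity gives the
  rest.\<close>

lemma relation_holds_Triv: "relation_holds (frag_of Triv)"
  unfolding relation_holds_def
proof (intro allI)
  let ?a = "frag_of Triv"
  fix x u v y
  show "ternary x (ternary u ?a v) y =
    ternary (ternary (parity_sign x) u ?a) v y + ternary x (parity_sign u) (ternary ?a v y)"
  proof (induction x rule: frag_linear_induct)
    case (one x)
    show ?case
    proof (induction y rule: frag_linear_induct)
      case (one y)
      show ?case
      proof (induction u rule: frag_linear_induct)
        case (one u)
        show ?case
        proof (induction v rule: frag_linear_induct)
          case (one v)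
          show ?case
            \<comment> \<open>Operations on trees are evaluated first; those left over are applied
              to linear combinations and get unfolded.\<close>
            by (simp add: ternary_linear ternary_frag_of) (simp add: ternary_def)
        qed (simp_all add: ternary_linear parity_sign_linear)
      qed (simp_all add: ternary_linear parity_sign_linear)
    qed (simp_all add: ternary_linear parity_sign_linear)
  qed (simp_all add: ternary_linear parity_sign_linear)
qed

text \<open>The confluence computation for the critical pair \<open>g \<circ>\<^sub>2 (g \<circ>\<^sub>2 g)\<close>.\<close>

lemma relation_holds_ternary:
  assumes "relation_holds p" "relation_holds (parity_sign p)" "relation_holds q"
  shows "relation_holds (ternary p (frag_of Triv) q)"
  unfolding relation_holds_def
proof (intro allI)
  let ?a = "frag_of Triv" and ?s = parity_sign
  fix x u v y
  note P = assms(1)[unfolded relation_holds_def, rule_format] and Q = assms(3)[unfolded relation_holds_def, rule_format]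
    and A = relation_holds_Triv[unfolded relation_holds_def, rule_format] and SP = assms(2)[unfolded relation_holds_def, rule_format]
  have "ternary x (ternary u (ternary p ?a q) v) y =
     ternary x (ternary (ternary (?s u) p ?a) q v) y + ternary x (ternary u (?s p) (ternary ?a q v)) y"
    by (simp add: A ternary_linear)
  also have "ternary x (ternary (ternary (?s u) p ?a) q v) y =
     ternary (ternary (?s x) (ternary (?s u) p ?a) q) v y + ternary x (?s (ternary (?s u) p ?a)) (ternary q v y)"
    by (rule Q)
  also have "ternary (?s x) (ternary (?s u) p ?a) q =
    ternary (ternary x (?s u) p) ?a q + ternary (?s x) u (ternary p ?a q)"
    by (simp add: P)
  also have "?s (ternary (?s u) p ?a) = - ternary u (?s p) ?a"
    by (simp add: parity_sign_ternary)
  also have "ternary x (- ternary u (?s p) ?a) (ternary q v y) =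
    - (ternary (ternary (?s x) u (?s p)) ?a (ternary q v y) + ternary x (?s u) (ternary (?s p) ?a (ternary q v y)))"
    by (simp add: ternary_linear SP)
  also have "ternary x (ternary u (?s p) (ternary ?a q v)) y =
     ternary (ternary (?s x) u (?s p)) (ternary ?a q v) y + ternary x (?s u) (ternary (?s p) (ternary ?a q v) y)"
    by (rule SP)
  also have "ternary (ternary (?s x) u (?s p)) (ternary ?a q v) y =
    ternary (ternary (?s (ternary (?s x) u (?s p))) ?a q) v y + ternary (ternary (?s x) u (?s p)) ?a (ternary q v y)"
    by (simp add: Q)
  also have "?s (ternary (?s x) u (?s p)) = - ternary x (?s u) p"
    by (simp add: parity_sign_ternary)
  also have "ternary (?s p) (ternary ?a q v) y = ternary (ternary p ?a q) v y + ternary (?s p) ?a (ternary q v y)"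
    by (simp add: Q)
  \<comment> \<open>Three pairs cancel: the terms with
    \<open>ternary (ternary x (?s u) p) ?a q\<close> on the left, those with \<open>?a\<close> as
    outer middle argument, and those containing \<open>ternary (?s p) ?a (ternary q v y)\<close>.
    The two terms with \<open>ternary p ?a q\<close> intact remain.\<close>
  finally show "ternary x (ternary u (ternary p ?a q) v) y =
    ternary (ternary (?s x) u (ternary p ?a q)) v y + ternary x (?s u) (ternary (ternary p ?a q) v y)"
    by (simp add: ternary_linear)
qed

text \<open>A tree \<open>Join p q\<close> is \<open>ternary\<close> of \<open>p\<close>,
  \<open>Triv\<close> and \<open>q\<close>, so induction on the tree applies. On a single tree
  \<open>parity_sign\<close> is a mere sign, which settles the extra hypothesis on
  \<open>parity_sign p\<close>.\<close>

lemma relation_holds_all: "relation_holds w"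
proof (induction w rule: frag_linear_induct)
  case (one w)
  show ?case
  proof (induction w)
    case Triv show ?case by (rule relation_holds_Triv)
  next
    case (Join p q)
    have "relation_holds (parity_sign (frag_of p))"
      using Join.IH(1) relation_holds_linear(3) by (cases "even (vertices p)") (simp_all add: psign_def)
    then have "relation_holds (ternary (frag_of p) (frag_of Triv) (frag_of q))"
      using Join.IH by (intro relation_holds_ternary)
    then show ?case by (simp add: ternary_frag_of)
  qed
qed (simp_all add: relation_holds_linear)

section \<open>The action of formal expressions\<close>

abbreviation weights :: "pbtree list \<Rightarrow> int" where "weights xs \<equiv> sum_list (map (\<lambda>x. int (vertices x)) xs)"

text \<open>Arguments are basis elements; the action is only meaningful on lists of length \<open>Vp.deg t\<close>.\<close>

primrec act :: "unit opterm \<Rightarrow> pbtree list \<Rightarrow> (pbtree \<Rightarrow>\<^sub>0 int)" where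
  "act Unit xs = frag_of (hd xs)"
| "act (Gen _) xs = graft (xs ! 1) (xs ! 0) (xs ! 2)"
| "act (Zero n k) xs = 0"
| "act (Neg t) xs = - act t xs"
| "act (Add s t) xs = act s xs + act t xs"
| "act (Comp i s t) xs =
     frag_cmul (psign (Vp.wt t * weights (take (i - 1) xs)))
       (frag_extend (\<lambda>z. act s (take (i - 1) xs @ z # drop (i - 1 + Vp.deg t) xs))
         (act t (take (Vp.deg t) (drop (i - 1) xs))))"

text \<open>The sign is the Koszul cost of moving \<open>t\<close> past the arguments
  \<open>A\<close> that precede its block \<open>B\<close>.\<close>

lemma act_Comp:
  assumes "i = Suc (length A)" "length B = Vp.deg t"
  shows "act (Comp i s t) (A @ B @ C) =
    frag_cmul (psign (Vp.wt t * weights A)) (frag_extend (\<lambda>z. act s (A @ z # C)) (act t B))"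
  using assms by simp

lemma split_list_lengths:
  assumes "length xs = m + n"
  obtains A B where "xs = A @ B" "length A = m" "length B = n"
  using assms that[of "take m xs" "drop m xs"] by simp

text \<open>The action is homogeneous. The weight of an intermediate result enters the Koszul signs
  in \<open>act_parallel\<close>.\<close>

lemma vertices_act:
  "\<lbrakk>Vp.wft t; length xs = Vp.deg t; z \<in> Poly_Mapping.keys (act t xs)\<rbrakk>
    \<Longrightarrow> int (vertices z) = Vp.wt t + weights xs"
proof (induction t arbitrary: xs z)
  case Unit
  then show ?case by (cases xs) auto
next
  case (Gen x)
  then have "length xs = Suc (Suc (Suc 0))" by simp
  then obtain a b c where "xs = [a, b, c]" by (auto simp: length_Suc_conv)
  then show ?case using Gen vertices_graft by fastforce
next
  case (Add s t)
  then have "z \<in> Poly_Mapping.keys (act s xs) \<union> Poly_Mapping.keys (act t xs)"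
    using Poly_Mapping.keys_add by fastforce
  then show ?case using Add by auto
next
  case (Comp i s t)
  then have "length xs = (i - 1) + (Vp.deg t + (Vp.deg s - i))" using Vp.deg_pos[of t] by auto
  then obtain A B C where xs: "xs = A @ B @ C" "length A = i - 1" "length B = Vp.deg t" "length C = Vp.deg s - i"
    by (metis split_list_lengths)
  have i: "i = Suc (length A)" using xs Comp.prems by simp
  have "z \<in> Poly_Mapping.keys (frag_extend (\<lambda>z. act s (A @ z # C)) (act t B))"
    using Comp.prems(3) unfolding xs act_Comp[OF i xs(3)] by auto
  then obtain w where w: "w \<in> Poly_Mapping.keys (act t B)" "z \<in> Poly_Mapping.keys (act s (A @ w # C))"
    using keys_frag_extend by fastforce
  have "int (vertices w) = Vp.wt t + weights B" using Comp w xs by simp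
  moreover have "int (vertices z) = Vp.wt s + weights (A @ w # C)"
    using Comp.prems xs by (intro Comp.IH(1) w(2)) auto
  ultimately show ?case using xs(1) by simp
qed auto

text \<open>With letters for weights, both sides carry the sign \<open>(-1)^(u(A + B) + tA)\<close>,
  as the composite of \<open>t\<close> and \<open>u\<close> has weight \<open>t + u\<close>.\<close>

lemma act_nested:
  assumes "length B + length D + 1 = Vp.deg t" "length C = Vp.deg u"
  shows "act (Comp (Suc (length B) + Suc (length A) - 1) (Comp (Suc (length A)) s t) u) (A @ B @ C @ D @ E) =
    act (Comp (Suc (length A)) s (Comp (Suc (length B)) t u)) (A @ B @ C @ D @ E)"
proof -
  have "act (Comp (Suc (length B) + Suc (length A) - 1) (Comp (Suc (length A)) s t) u) ((A @ B) @ C @ (D @ E)) =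
    frag_cmul (psign (Vp.wt u * weights (A @ B))) (frag_extend (\<lambda>z.
     frag_cmul (psign (Vp.wt t * weights A)) (frag_extend (\<lambda>z. act s (A @ z # E)) (act t (B @ z # D)))) (act u C))"
    using assms act_Comp[of "Suc (length A)" A "B @ _ # D" t s E]
    by (subst act_Comp) simp_all
  moreover have "act (Comp (Suc (length A)) s (Comp (Suc (length B)) t u)) (A @ (B @ C @ D) @ E) =
    frag_cmul (psign (Vp.wt (Comp (Suc (length B)) t u) * weights A)) (frag_extend (\<lambda>z. act s (A @ z # E))
      (frag_cmul (psign (Vp.wt u * weights B)) (frag_extend (\<lambda>z. act t (B @ z # D)) (act u C))))"
    using assms act_Comp[of "Suc (length B)" B C u t D]
    by (subst act_Comp) simp_all
  ultimately show ?thesis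
    by (simp add: frag_extend_cmul frag_extend_fun_cmul frag_extend_extend psign_add algebra_simps)
qed

text \<open>On the right-hand side the result of \<open>t\<close> on \<open>B\<close> already stands
  to the left of \<open>u\<close>, with weight \<open>t + B\<close> instead of \<open>B\<close>.
  This is the extra sign \<open>(-1)^(tu)\<close>; the two linear extensions are then
  interchanged.\<close>

lemma act_parallel:
  assumes "Vp.wft s" "Vp.wft t" "Vp.wft u" "length A + length C + length E + 2 = Vp.deg s"
    "length B = Vp.deg t" "length D = Vp.deg u"
  shows "act (Comp (length A + length C + 2 + Vp.deg t - 1) (Comp (Suc (length A)) s t) u) (A @ B @ C @ D @ E) =
    frag_cmul (psign (Vp.wt t * Vp.wt u))
     (act (Comp (Suc (length A)) (Comp (length A + length C + 2) s u) t) (A @ B @ C @ D @ E))"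
proof -
  have "act (Comp (length A + length C + 2 + Vp.deg t - 1) (Comp (Suc (length A)) s t) u) ((A @ B @ C) @ D @ E) =
    frag_cmul (psign (Vp.wt u * weights (A @ B @ C))) (frag_extend (\<lambda>z.
     frag_cmul (psign (Vp.wt t * weights A)) (frag_extend (\<lambda>w. act s (A @ w # C @ z # E)) (act t B))) (act u D))"
    using assms act_Comp[of "Suc (length A)" A B t s "C @ _ # E"]
    by (subst act_Comp) simp_all
  moreover have "act (Comp (Suc (length A)) (Comp (length A + length C + 2) s u) t) (A @ B @ (C @ D @ E)) =
    frag_cmul (psign (Vp.wt t * weights A)) (frag_extend (\<lambda>w.
      frag_cmul (psign (Vp.wt u * (weights A + Vp.wt t + weights B + weights C)))
      (frag_extend (\<lambda>z. act s (A @ w # C @ z # E)) (act u D))) (act t B))"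
  proof (subst act_Comp)
    have "act (Comp (length A + length C + 2) s u) (A @ w # (C @ D @ E)) =
      frag_cmul (psign (Vp.wt u * (weights A + Vp.wt t + weights B + weights C)))
        (frag_extend (\<lambda>z. act s (A @ w # C @ z # E)) (act u D))"
      if "w \<in> Poly_Mapping.keys (act t B)" for w
      using vertices_act[OF assms(2,5) that] assms act_Comp[of "length A + length C + 2" "A @ w # C" D u s E]
      by (simp add: algebra_simps)
    then show "frag_cmul (psign (Vp.wt t * weights A))
     (frag_extend (\<lambda>z. act (Comp (length A + length C + 2) s u) (A @ z # C @ D @ E)) (act t B)) =
     frag_cmul (psign (Vp.wt t * weights A))
     (frag_extend (\<lambda>w. frag_cmul (psign (Vp.wt u * (weights A + Vp.wt t + weights B + weights C)))
              (frag_extend (\<lambda>z. act s (A @ w # C @ z # E)) (act u D))) (act t B))"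
      by (simp cong: frag_extend_eq_cong)
  qed (use assms in auto)
  moreover have "psign (Vp.wt t * Vp.wt u) * psign (Vp.wt u * Vp.wt t) = 1"
    by (simp add: mult.commute)
  ultimately show ?thesis
    by (simp add: frag_extend_fun_cmul frag_extend_swap[of _ "act t B"] psign_add algebra_simps)
qed

text \<open>This is \<open>relation_holds_all\<close> at the third input, multiplied by the sign
  \<open>(-1)^x\<close> that \<open>Comp 2\<close> produces when the inner \<open>g\<close> passes
  \<open>x\<close>.\<close>

lemma act_V_relator:
  assumes "length xs = 5"
  shows "act V_relator xs = 0"
proof -
  obtain x u w v y where xs: "xs = [x, u, w, v, y]"
    using assms by (auto simp: numeral_eq_Suc length_Suc_conv)
  let ?f = "frag_of :: pbtree \<Rightarrow> _"
  have "ternary (?f x) (ternary (?f u) (?f w) (?f v)) (?f y) =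
    ternary (ternary (parity_sign (?f x)) (?f u) (?f w)) (?f v) (?f y) + ternary (?f x) (parity_sign (?f u)) (ternary (?f w) (?f v) (?f y))"
    using relation_holds_all[of "?f w"] by (simp add: relation_holds_def)
  then have "frag_extend (\<lambda>z. graft z x y) (graft w u v) =
    frag_cmul (psign (vertices x)) (frag_extend (\<lambda>z. graft v z y) (graft u x w)) +
    frag_cmul (psign (vertices u)) (frag_extend (\<lambda>z. graft u x z) (graft v w y))"
    by (simp add: ternary_linear ternary_frag_of) (simp add: ternary_def)
  then show ?thesis
    by (simp add: V_relator_def Let_def xs frag_cmul_distrib2 psign_add flip: minus_frag_cmul)
qed

text \<open>Soundness: every rule generating the congruence holds after evaluation, so classes act.
  Congruent expressions have equal degree, so fixing the length by \<open>s\<close> fixes it for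
  \<open>t\<close>.\<close>

lemma act_eqv: "Vp.eqv s t \<Longrightarrow> length xs = Vp.deg s \<Longrightarrow> act s xs = act t xs"
proof (induction arbitrary: xs rule: Vp.eqv.induct)
  case (sym s t)
  then show ?case by (metis Vp.eqv_invariant)
next
  case (trans s t u)
  then show ?case by (metis Vp.eqv_invariant)
next
  case (cong_Add s s' t t')
  then show ?case by simp
next
  case (cong_Comp s s' t t' i)
  have *: "Vp.deg t' = Vp.deg t" "Vp.wt t' = Vp.wt t" using cong_Comp Vp.eqv_invariant by metis+
  have "length (take (Vp.deg t) (drop (i - 1) xs)) = Vp.deg t"
    "\<And>z. length (take (i - 1) xs @ z # drop (i - 1 + Vp.deg t) xs) = Vp.deg s"
    using cong_Comp.prems cong_Comp.hyps by auto
  then show ?case using cong_Comp.IH * by (simp del: length_take length_append)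
next
  case (Comp_Add_left i s s' t)
  then show ?case by (simp add: frag_extend_fun_add frag_cmul_distrib2)
next
  case (Comp_Add_right i s t t')
  then show ?case by (simp add: frag_extend_add frag_cmul_distrib2)
next
  case (Unit_left t)
  then show ?case by (simp flip: frag_expansion)
next
  case (Unit_right i t)
  then have "take 1 (drop (i - 1) xs) = [xs ! (i - 1)]"
    using Cons_nth_drop_Suc[of "i - 1" xs] by (cases "drop (i - 1) xs") auto
  moreover have "take (i - 1) xs @ xs ! (i - 1) # drop (Suc (i - 1)) xs = xs"
    using Unit_right by (intro id_take_nth_drop[symmetric]) auto
  moreover have "Suc (i - 1) = i" using Unit_right by simp
  ultimately show ?case using Unit_right by simp
next
  case (Comp_nested s t u i j)
  have "length xs = (i - 1) + ((j - 1) + (Vp.deg u + ((Vp.deg t - j) + (Vp.deg s - i))))"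
    using Comp_nested Vp.deg_pos[of u] by simp
  then obtain A B C D E where xs: "xs = A @ B @ C @ D @ E" "length A = i - 1" "length B = j - 1"
    "length C = Vp.deg u" "length D = Vp.deg t - j"
    by (metis split_list_lengths)
  have ij: "i = Suc (length A)" "j = Suc (length B)" using xs Comp_nested by auto
  show ?case
    unfolding ij xs(1) by (rule act_nested) (use xs Comp_nested in auto)
next
  case (Comp_parallel s t u i j)
  have "length xs = (i - 1) + (Vp.deg t + ((j - i - 1) + (Vp.deg u + (Vp.deg s - j))))"
    using Comp_parallel Vp.deg_pos[of u] Vp.deg_pos[of t] by simp
  then obtain A B C D E where xs: "xs = A @ B @ C @ D @ E" "length A = i - 1" "length B = Vp.deg t"
    "length C = j - i - 1" "length D = Vp.deg u" "length E = Vp.deg s - j"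
    by (metis split_list_lengths)
  have ij: "i = Suc (length A)" "j = length A + length C + 2" using xs Comp_parallel by auto
  have "act (Comp (length A + length C + 2 + Vp.deg t - 1) (Comp (Suc (length A)) s t) u) xs =
    frag_cmul (psign (Vp.wt t * Vp.wt u)) (act (Comp (Suc (length A)) (Comp (length A + length C + 2) s u) t) xs)"
    unfolding xs(1) by (rule act_parallel) (use xs Comp_parallel in auto)
  then show ?case unfolding ij by (simp add: sgn_term_def psign_def del: act.simps(6))
next
  case (relator r)
  then show ?case using act_V_relator by (simp add: V_relator_def Let_def)
qed (auto simp: add_ac)

section \<open>Formal expressions up to sign\<close>

context operad_presentation begin

lemmas [trans] = eqv.trans

lemma Add_eq_Zero_imp_eqv_Neg:
  assumes "Add s t \<doteq> Zero n k"
  shows "s \<doteq> Neg t"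
proof -
  have w: "wft s" "wft t" "deg s = n" "deg t = n" "wt s = k" "wt t = k"
    using eqv_invariant[OF assms] by auto
  interpret comm_group "presented_component n k"
    using comm_group_presented deg_pos[OF w(1)] w by simp
  have "cls s \<otimes>\<^bsub>presented_component n k\<^esub> cls t = \<one>\<^bsub>presented_component n k\<^esub>"
    using w assms by (simp add: mult_cls one_presented cls_eq_iff)
  then have "inv\<^bsub>presented_component n k\<^esub> cls t = cls s"
    using w by (intro inv_equality) (auto simp: carrier_presented)
  then show ?thesis using w by (simp add: inv_cls cls_eq_iff eqv.sym)
qed

text \<open>Cancellation in the component group. A composite with \<open>Zero\<close> is its own
  double by additivity, hence vanishes.\<close>

lemma Add_self_imp_eqv_Zero:
  assumes "Add s s \<doteq> s"
  shows "s \<doteq> Zero (deg s) (wt s)"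
proof -
  have w: "wft s" using eqv_invariant[OF assms] by auto
  interpret comm_group "presented_component (deg s) (wt s)"
    using comm_group_presented deg_pos[OF w] by simp
  have c: "cls s \<in> carrier (presented_component (deg s) (wt s))"
    using w by (auto simp: carrier_presented)
  have "cls s \<otimes>\<^bsub>presented_component (deg s) (wt s)\<^esub> cls s = cls s"
    using w assms by (simp add: mult_cls cls_eq_iff)
  then show ?thesis using w c l_cancel_one' by (simp add: one_presented cls_eq_iff)
qed

lemma Comp_Zero_left: "wft (Comp i (Zero n k) t) \<Longrightarrow> Comp i (Zero n k) t \<doteq> Zero (n + deg t - 1) (k + wt t)"
proof -
  assume w: "wft (Comp i (Zero n k) t)"
  have "Add (Comp i (Zero n k) t) (Comp i (Zero n k) t) \<doteq> Comp i (Add (Zero n k) (Zero n k)) t"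
    using w by (intro eqv.sym[OF eqv.Comp_Add_left]) simp
  also have "\<dots> \<doteq> Comp i (Zero n k) t"
    using w eqv.Add_Zero[of "Zero n k"] by (intro eqv.cong_Comp) (auto intro: eqv.refl)
  finally show ?thesis
    by (rule Add_self_imp_eqv_Zero[THEN eqv.trans])
      (use w deg_pos[of "Zero n k"] deg_pos[of t] in \<open>auto intro!: eqv.refl\<close>)
qed

lemma Comp_Zero_right: "wft (Comp i s (Zero n k)) \<Longrightarrow> Comp i s (Zero n k) \<doteq> Zero (deg s + n - 1) (wt s + k)"
proof -
  assume w: "wft (Comp i s (Zero n k))"
  have "Add (Comp i s (Zero n k)) (Comp i s (Zero n k)) \<doteq> Comp i s (Add (Zero n k) (Zero n k))"
    using w by (intro eqv.sym[OF eqv.Comp_Add_right]) simp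
  also have "\<dots> \<doteq> Comp i s (Zero n k)"
    using w eqv.Add_Zero[of "Zero n k"] by (intro eqv.cong_Comp) (auto intro: eqv.refl)
  finally show ?thesis
    by (rule Add_self_imp_eqv_Zero[THEN eqv.trans])
      (use w deg_pos[of "Zero n k"] deg_pos[of s] in \<open>auto intro!: eqv.refl\<close>)
qed

lemma Comp_Neg_left:
  assumes "wft (Comp i s t)" shows "Comp i (Neg s) t \<doteq> Neg (Comp i s t)"
proof (rule Add_eq_Zero_imp_eqv_Neg)
  have "Add (Comp i (Neg s) t) (Comp i s t) \<doteq> Comp i (Add (Neg s) s) t"
    using assms by (intro eqv.sym[OF eqv.Comp_Add_left]) simp
  also have "\<dots> \<doteq> Comp i (Zero (deg s) (wt s)) t"
    using assms by (intro eqv.cong_Comp eqv.Add_Neg) (auto intro: eqv.refl)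
  also have "\<dots> \<doteq> Zero (deg s + deg t - 1) (wt s + wt t)"
    using assms deg_pos[of s] by (intro Comp_Zero_left) simp
  finally show "Add (Comp i (Neg s) t) (Comp i s t) \<doteq> Zero (deg s + deg t - 1) (wt s + wt t)" .
qed

lemma Comp_Neg_right:
  assumes "wft (Comp i s t)" shows "Comp i s (Neg t) \<doteq> Neg (Comp i s t)"
proof (rule Add_eq_Zero_imp_eqv_Neg)
  have "Add (Comp i s (Neg t)) (Comp i s t) \<doteq> Comp i s (Add (Neg t) t)"
    using assms by (intro eqv.sym[OF eqv.Comp_Add_right]) simp
  also have "\<dots> \<doteq> Comp i s (Zero (deg t) (wt t))"
    using assms by (intro eqv.cong_Comp eqv.Add_Neg) (auto intro: eqv.refl)
  also have "\<dots> \<doteq> Zero (deg s + deg t - 1) (wt s + wt t)"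
    using assms deg_pos[of t] by (intro Comp_Zero_right) simp
  finally show "Add (Comp i s (Neg t)) (Comp i s t) \<doteq> Zero (deg s + deg t - 1) (wt s + wt t)" .
qed

lemma Neg_Neg: "wft t \<Longrightarrow> Neg (Neg t) \<doteq> t"
proof (rule eqv.sym, rule Add_eq_Zero_imp_eqv_Neg)
  assume w: "wft t"
  have "Add t (Neg t) \<doteq> Add (Neg t) t" using w by (intro eqv.Add_commute) simp
  also have "\<dots> \<doteq> Zero (deg t) (wt t)" using w by (rule eqv.Add_Neg)
  finally show "Add t (Neg t) \<doteq> Zero (deg t) (wt t)" .
qed

text \<open>Spans are closed under opposites, so the spanning argument may forget Koszul signs; up
  to sign the parallel axiom is a plain exchange.\<close>

definition eqv_pm :: "'g opterm \<Rightarrow> 'g opterm \<Rightarrow> bool" (infix \<open>\<plusminus>\<doteq>\<close> 50)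
  where "s \<plusminus>\<doteq> t \<longleftrightarrow> s \<doteq> t \<or> s \<doteq> Neg t"

lemma eqv_imp_pm: "s \<doteq> t \<Longrightarrow> s \<plusminus>\<doteq> t" by (simp add: eqv_pm_def)

lemma eqv_pm_sgn: "s \<doteq> sgn_term k t \<Longrightarrow> s \<plusminus>\<doteq> t"
  by (auto simp: sgn_term_def eqv_pm_def split: if_splits)

lemma eqv_Neg_swap: "s \<doteq> Neg t \<Longrightarrow> t \<doteq> Neg s"
proof -
  assume "s \<doteq> Neg t"
  then have "Neg s \<doteq> Neg (Neg t)" "wft t" using eqv_invariant[of s "Neg t"] by (auto intro: eqv.cong_Neg)
  then have "Neg s \<doteq> t" using eqv.trans[OF _ Neg_Neg] by blast
  then show ?thesis by (rule eqv.sym)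
qed

lemma eqv_pm_sym: "s \<plusminus>\<doteq> t \<Longrightarrow> t \<plusminus>\<doteq> s"
  unfolding eqv_pm_def using eqv.sym eqv_Neg_swap by blast

lemma eqv_pm_trans [trans]:
  assumes "s \<plusminus>\<doteq> t" "t \<plusminus>\<doteq> u" shows "s \<plusminus>\<doteq> u"
  using assms(1) unfolding eqv_pm_def
proof
  assume "s \<doteq> t"
  then show "s \<doteq> u \<or> s \<doteq> Neg u" using assms(2) eqv.trans unfolding eqv_pm_def by blast
next
  assume s: "s \<doteq> Neg t"
  from assms(2) have "Neg t \<doteq> Neg u \<or> Neg t \<doteq> u"
    unfolding eqv_pm_def using eqv.cong_Neg eqv_Neg_swap eqv.sym by blast
  with s show "s \<doteq> u \<or> s \<doteq> Neg u" using eqv.trans by blast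
qed

lemma eqv_pm_invariant: "s \<plusminus>\<doteq> t \<Longrightarrow> wft s \<and> wft t \<and> deg s = deg t \<and> wt s = wt t"
  unfolding eqv_pm_def using eqv_invariant by fastforce

lemma eqv_pm_Comp_left:
  assumes "s \<plusminus>\<doteq> s'" "wft (Comp i s t)" shows "Comp i s t \<plusminus>\<doteq> Comp i s' t"
proof -
  have w: "wft (Comp i s' t)" "wft t" using assms eqv_pm_invariant[of s s'] by auto
  from assms(1) show ?thesis
    unfolding eqv_pm_def
  proof (elim disj_forward)
    show "s \<doteq> s' \<Longrightarrow> Comp i s t \<doteq> Comp i s' t"
      using assms w by (intro eqv.cong_Comp eqv.refl)
    assume "s \<doteq> Neg s'"
    then have "Comp i s t \<doteq> Comp i (Neg s') t" using assms w by (intro eqv.cong_Comp eqv.refl)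
    then show "Comp i s t \<doteq> Neg (Comp i s' t)" using Comp_Neg_left[OF w(1)] by (rule eqv.trans)
  qed
qed

lemma eqv_pm_Comp_right:
  assumes "t \<plusminus>\<doteq> t'" "wft (Comp i s t)" shows "Comp i s t \<plusminus>\<doteq> Comp i s t'"
proof -
  have w: "wft (Comp i s t')" "wft s" using assms eqv_pm_invariant[of t t'] by auto
  from assms(1) show ?thesis
    unfolding eqv_pm_def
  proof (elim disj_forward)
    show "t \<doteq> t' \<Longrightarrow> Comp i s t \<doteq> Comp i s t'"
      using assms w by (intro eqv.cong_Comp eqv.refl)
    assume "t \<doteq> Neg t'"
    then have "Comp i s t \<doteq> Comp i s (Neg t')" using assms w by (intro eqv.cong_Comp eqv.refl)
    then show "Comp i s t \<doteq> Neg (Comp i s t')" using Comp_Neg_right[OF w(1)] by (rule eqv.trans)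
  qed
qed

text \<open>The index \<open>l\<close> is a variable constrained by a premise, so that the rule
  matches compositions written with numerals.\<close>

lemma eqv_pm_parallel:
  "\<lbrakk>wft s; wft t; wft u; 1 \<le> i; i < j; j \<le> deg s; l = j + deg t - 1\<rbrakk>
    \<Longrightarrow> Comp l (Comp i s t) u \<plusminus>\<doteq> Comp i (Comp j s u) t"
  by (simp only:) (rule eqv_pm_sgn, rule eqv.Comp_parallel)

lemma eqv_pm_nested:
  "\<lbrakk>wft s; wft t; wft u; 1 \<le> i; i \<le> deg s; 1 \<le> j; j \<le> deg t; l = j + i - 1\<rbrakk>
    \<Longrightarrow> Comp l (Comp i s t) u \<plusminus>\<doteq> Comp i s (Comp j t u)"
  by (simp only:) (rule eqv_imp_pm, rule eqv.Comp_nested)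

text \<open>Linearity on expressions of degree at least \<open>m\<close>, the ones that may be composed at input \<open>m\<close>.\<close>

definition linear_op :: "nat \<Rightarrow> ('g opterm \<Rightarrow> 'g opterm) \<Rightarrow> bool" where
  "linear_op m f \<longleftrightarrow>
    (\<forall>n k. 1 \<le> n \<longrightarrow> m \<le> n \<longrightarrow> (\<exists>n' k'. f (Zero n k) \<doteq> Zero n' k')) \<and>
    (\<forall>t. wft t \<longrightarrow> m \<le> deg t \<longrightarrow> f (Neg t) \<doteq> Neg (f t)) \<and>
    (\<forall>s t. wft (Add s t) \<longrightarrow> m \<le> deg s \<longrightarrow> f (Add s t) \<doteq> Add (f s) (f t)) \<and>
    (\<forall>s t. s \<doteq> t \<longrightarrow> m \<le> deg s \<longrightarrow> f s \<doteq> f t)"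

lemma linear_op_Comp_left: "wft t \<Longrightarrow> 1 \<le> i \<Longrightarrow> linear_op i (\<lambda>s. Comp i s t)"
  unfolding linear_op_def
proof (intro conjI allI impI)
  fix n :: nat and k :: int assume "wft t" "1 \<le> i" "1 \<le> n" "i \<le> n"
  then have "Comp i (Zero n k) t \<doteq> Zero (n + deg t - 1) (k + wt t)" by (intro Comp_Zero_left) simp
  then show "\<exists>n' k'. Comp i (Zero n k) t \<doteq> Zero n' k'" by blast
next
  fix s s' assume "wft t" "1 \<le> i" "s \<doteq> s'" "i \<le> deg s"
  then show "Comp i s t \<doteq> Comp i s' t"
    using eqv_invariant[of s s'] by (intro eqv.cong_Comp eqv.refl) auto
qed (auto intro: Comp_Neg_left eqv.Comp_Add_left)

lemma linear_op_Comp_right: "wft s \<Longrightarrow> 1 \<le> i \<Longrightarrow> i \<le> deg s \<Longrightarrow> linear_op 1 (\<lambda>t. Comp i s t)"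
  unfolding linear_op_def
proof (intro conjI allI impI)
  fix n :: nat and k :: int assume "wft s" "1 \<le> i" "i \<le> deg s" "1 \<le> n"
  then have "Comp i s (Zero n k) \<doteq> Zero (deg s + n - 1) (wt s + k)" by (intro Comp_Zero_right) simp
  then show "\<exists>n' k'. Comp i s (Zero n k) \<doteq> Zero n' k'" by blast
next
  fix t t' assume "wft s" "1 \<le> i" "i \<le> deg s" "t \<doteq> t'"
  then show "Comp i s t \<doteq> Comp i s t'"
    using eqv_invariant[of t t'] by (intro eqv.cong_Comp eqv.refl) auto
qed (auto intro: Comp_Neg_right eqv.Comp_Add_right)

text \<open>Inputs are filled one after another; condition \<open>w\<close> ensures that an
  \<open>m'\<close>-th input still exists once \<open>f\<close> has been applied.\<close>

lemma linear_op_compose: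
  assumes f: "linear_op m f" and g: "linear_op m' g"
    and w: "\<And>t. wft t \<Longrightarrow> m \<le> deg t \<Longrightarrow> wft (f t) \<and> m' \<le> deg (f t)"
  shows "linear_op m (\<lambda>t. g (f t))"
  unfolding linear_op_def
proof (intro conjI allI impI)
  fix n :: nat and k :: int assume n: "1 \<le> n" "m \<le> n"
  then obtain n' k' where z: "f (Zero n k) \<doteq> Zero n' k'" using f unfolding linear_op_def by blast
  have w': "wft (f (Zero n k))" "m' \<le> deg (f (Zero n k))" using w[of "Zero n k"] n by auto
  then have "g (f (Zero n k)) \<doteq> g (Zero n' k')" using g z unfolding linear_op_def by blast
  moreover have "1 \<le> n'" "m' \<le> n'" using w' eqv_invariant[OF z] by auto
  then obtain n'' k'' where "g (Zero n' k') \<doteq> Zero n'' k''" using g unfolding linear_op_def by blast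
  ultimately show "\<exists>n' k'. g (f (Zero n k)) \<doteq> Zero n' k'" using eqv.trans by blast
next
  fix t assume t: "wft t" "m \<le> deg t"
  then have "f (Neg t) \<doteq> Neg (f t)" using f unfolding linear_op_def by blast
  moreover have "m' \<le> deg (f (Neg t))" using w[of "Neg t"] t by simp
  ultimately have "g (f (Neg t)) \<doteq> g (Neg (f t))" using g unfolding linear_op_def by blast
  moreover have "g (Neg (f t)) \<doteq> Neg (g (f t))" using g w[OF t] unfolding linear_op_def by blast
  ultimately show "g (f (Neg t)) \<doteq> Neg (g (f t))" by (rule eqv.trans)
next
  fix s t assume t: "wft (Add s t)" "m \<le> deg s"
  then have a: "f (Add s t) \<doteq> Add (f s) (f t)" using f unfolding linear_op_def by blast
  moreover have "m' \<le> deg (f (Add s t))" using w[of "Add s t"] t by simp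
  ultimately have "g (f (Add s t)) \<doteq> g (Add (f s) (f t))" using g unfolding linear_op_def by blast
  moreover have "wft (Add (f s) (f t))" using eqv_invariant[OF a] by blast
  then have "g (Add (f s) (f t)) \<doteq> Add (g (f s)) (g (f t))"
    using g w[of s] t unfolding linear_op_def by simp
  ultimately show "g (f (Add s t)) \<doteq> Add (g (f s)) (g (f t))" by (rule eqv.trans)
next
  fix s t assume t: "s \<doteq> t" "m \<le> deg s"
  then have "f s \<doteq> f t" using f unfolding linear_op_def by blast
  moreover have "m' \<le> deg (f s)" using w[of s] t eqv_invariant[of s t] by simp
  ultimately show "g (f s) \<doteq> g (f t)" using g unfolding linear_op_def by blast
qed

end

section \<open>Spanning\<close>

notation Vp.eqv (infix \<open>\<doteq>\<close> 50) and Vp.eqv_pm (infix \<open>\<plusminus>\<doteq>\<close> 50)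

abbreviation gen :: "unit opterm" where "gen \<equiv> Gen ()"

text \<open>Representatives follow the formula of \<open>Q_Join'\<close>: filling the last input
  first keeps the indices 3 and 1 independent of the subtrees.\<close>

primrec Qterm :: "pbtree \<Rightarrow> unit opterm" where
  "Qterm Triv = Unit"
| "Qterm (Join x y) = sgn_term (int (vertices x) + int (vertices x) * int (vertices y))
     (Comp 1 (Comp 3 gen (Qterm y)) (Qterm x))"

lemma Qterm_wft [simp]:
  "Vp.wft (Qterm x)" "Vp.deg (Qterm x) = 2 * vertices x + 1" "Vp.wt (Qterm x) = int (vertices x)"
proof -
  have "Vp.wft (Qterm x) \<and> Vp.deg (Qterm x) = 2 * vertices x + 1 \<and> Vp.wt (Qterm x) = int (vertices x)"
    by (induction x) auto
  then show "Vp.wft (Qterm x)" "Vp.deg (Qterm x) = 2 * vertices x + 1" "Vp.wt (Qterm x) = int (vertices x)"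
    by auto
qed

lemma Q_eq_cls: "Q x = Vp.cls (Qterm x)"
proof (induction x)
  case Triv
  then show ?case by (simp add: V_def)
next
  case (Join x y)
  show ?case
    unfolding Q_Join' Let_def Join.IH
    by (simp add: V_def V_gen_def Vp.circ_cls Vp.signed_cls)
qed

text \<open>The subgroups generated by the classes of the \<open>Qterm x\<close>, in all degrees and
  weights at once; \<open>spanned_eqv\<close> makes this a property of classes.\<close>

inductive spanned :: "unit opterm \<Rightarrow> bool" where
  spanned_Zero: "1 \<le> n \<Longrightarrow> spanned (Zero n k)"
| spanned_Qterm: "spanned (Qterm x)"
| spanned_Neg: "spanned t \<Longrightarrow> spanned (Neg t)"
| spanned_Add: "spanned s \<Longrightarrow> spanned t \<Longrightarrow> Vp.wft (Add s t) \<Longrightarrow> spanned (Add s t)"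
| spanned_eqv: "spanned s \<Longrightarrow> s \<doteq> t \<Longrightarrow> spanned t"

lemma spanned_wft: "spanned t \<Longrightarrow> Vp.wft t"
  by (induction rule: spanned.induct) (use Vp.eqv_invariant in auto)

lemma spanned_pm: "s \<plusminus>\<doteq> t \<Longrightarrow> spanned t \<Longrightarrow> spanned s"
  unfolding Vp.eqv_pm_def using spanned_Neg spanned_eqv[OF _ Vp.eqv.sym] by blast

text \<open>Reduces closure of the span under a linear operation to its values on trees.\<close>

lemma spanned_linear_op:
  assumes f: "Vp.linear_op m f" and t: "spanned t" "m \<le> Vp.deg t"
    and Q: "\<And>x. m \<le> Vp.deg (Qterm x) \<Longrightarrow> spanned (f (Qterm x))"
  shows "spanned (f t)"
  using t
proof (induction rule: spanned.induct)
  case (spanned_Zero n k)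
  then have "\<exists>n' k'. f (Zero n k) \<doteq> Zero n' k'" using f unfolding Vp.linear_op_def by simp
  then obtain n' k' where z: "f (Zero n k) \<doteq> Zero n' k'" by blast
  have "spanned (Zero n' k')" using Vp.eqv_invariant[OF z] by (intro spanned.spanned_Zero) simp
  then show ?case by (rule spanned_eqv[OF _ Vp.eqv.sym[OF z]])
next
  case (spanned_Qterm x)
  then show ?case by (intro Q)
next
  case (spanned_Neg t)
  then have *: "f (Neg t) \<doteq> Neg (f t)" using f spanned_wft unfolding Vp.linear_op_def by simp
  have "spanned (Neg (f t))" using spanned_Neg by (intro spanned.spanned_Neg) simp
  then show ?case by (rule spanned_eqv[OF _ Vp.eqv.sym[OF *]])
next
  case (spanned_Add s t)
  then have *: "f (Add s t) \<doteq> Add (f s) (f t)" using f unfolding Vp.linear_op_def by simp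
  then have "spanned (Add (f s) (f t))"
    using spanned_Add Vp.eqv_invariant[OF *] by (intro spanned.spanned_Add) auto
  then show ?case by (rule spanned_eqv[OF _ Vp.eqv.sym[OF *]])
next
  case (spanned_eqv s t)
  then have m: "m \<le> Vp.deg s" using Vp.eqv_invariant[of s t] by simp
  then have "f s \<doteq> f t" using spanned_eqv f unfolding Vp.linear_op_def by simp
  then show ?case by (rule spanned.spanned_eqv[OF spanned_eqv.IH[OF m]])
qed

text \<open>
  Inputs are substituted from right to left, so that the indices do not depend on the degrees of
  the arguments.
\<close>

definition subst3 :: "unit opterm \<Rightarrow> unit opterm \<Rightarrow> unit opterm \<Rightarrow> unit opterm"
  where "subst3 s b t = Comp 1 (Comp 2 (Comp 3 gen t) b) s"

lemma subst3_wft [simp]: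
  assumes "Vp.wft s" "Vp.wft b" "Vp.wft t"
  shows "Vp.wft (subst3 s b t)" "Vp.deg (subst3 s b t) = Vp.deg s + Vp.deg b + Vp.deg t"
    "Vp.wt (subst3 s b t) = Vp.wt s + Vp.wt b + Vp.wt t + 1"
  using assms Vp.deg_pos[of s] Vp.deg_pos[of b] Vp.deg_pos[of t] by (auto simp: subst3_def)

text \<open>The third input stays open; it plays the part of the trivial tree between
  \<open>u\<close> and \<open>v\<close>.\<close>

definition subst5 :: "unit opterm \<Rightarrow> unit opterm \<Rightarrow> unit opterm \<Rightarrow> unit opterm \<Rightarrow> unit opterm \<Rightarrow> unit opterm"
  where "subst5 w s u v t = Comp 1 (Comp 2 (Comp 4 (Comp 5 w t) v) u) s"

lemma gen_wft [simp]: "Vp.wft gen" by simp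

context
  fixes s u v t assumes w [simp]: "Vp.wft s" "Vp.wft u" "Vp.wft v" "Vp.wft t"
begin

private lemma deg_ge_1 [simp]: "Suc 0 \<le> Vp.deg s" "Suc 0 \<le> Vp.deg u" "Suc 0 \<le> Vp.deg v" "Suc 0 \<le> Vp.deg t"
  using Vp.deg_pos w by auto

text \<open>Here and in the next two lemmas the terms of the relation are evaluated. The middle
  argument of \<open>subst3\<close> is \<open>v\<close> for \<open>g \<circ>\<^sub>1 g\<close>,
  \<open>u\<close> for \<open>g \<circ>\<^sub>3 g\<close>, and the join of both for
  \<open>g \<circ>\<^sub>2 g\<close>: the relation trades a middle tree for its two
  subtrees.\<close>

lemma subst5_gen_1: "subst5 (Comp 1 gen gen) s u v t \<plusminus>\<doteq> subst3 (Comp 1 (Comp 2 gen u) s) v t"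
proof -
  let ?X = "Comp 2 (Comp 3 gen t) v"
  have "Comp 5 (Comp 1 gen gen) t \<plusminus>\<doteq> Comp 1 (Comp 3 gen t) gen"
    by (rule Vp.eqv_pm_parallel) auto
  then have "Comp 4 (Comp 5 (Comp 1 gen gen) t) v \<plusminus>\<doteq> Comp 4 (Comp 1 (Comp 3 gen t) gen) v"
    by (rule Vp.eqv_pm_Comp_left) auto
  also have "\<dots> \<plusminus>\<doteq> Comp 1 ?X gen"
    by (rule Vp.eqv_pm_parallel) auto
  finally have "Comp 2 (Comp 4 (Comp 5 (Comp 1 gen gen) t) v) u \<plusminus>\<doteq> Comp 2 (Comp 1 ?X gen) u"
    by (rule Vp.eqv_pm_Comp_left) auto
  also have "\<dots> \<plusminus>\<doteq> Comp 1 ?X (Comp 2 gen u)"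
    by (rule Vp.eqv_pm_nested) auto
  finally have "subst5 (Comp 1 gen gen) s u v t \<plusminus>\<doteq> Comp 1 (Comp 1 ?X (Comp 2 gen u)) s"
    unfolding subst5_def by (rule Vp.eqv_pm_Comp_left) auto
  also have "\<dots> \<plusminus>\<doteq> subst3 (Comp 1 (Comp 2 gen u) s) v t"
    unfolding subst3_def by (rule Vp.eqv_pm_nested) auto
  finally show ?thesis .
qed

lemma subst5_gen_2: "subst5 (Comp 2 gen gen) s u v t \<plusminus>\<doteq> subst3 s (Comp 1 (Comp 3 gen v) u) t"
proof -
  let ?X = "Comp 3 gen t"
  have "Comp 5 (Comp 2 gen gen) t \<plusminus>\<doteq> Comp 2 ?X gen"
    by (rule Vp.eqv_pm_parallel) auto
  then have "Comp 4 (Comp 5 (Comp 2 gen gen) t) v \<plusminus>\<doteq> Comp 4 (Comp 2 ?X gen) v"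
    by (rule Vp.eqv_pm_Comp_left) auto
  also have "\<dots> \<plusminus>\<doteq> Comp 2 ?X (Comp 3 gen v)"
    by (rule Vp.eqv_pm_nested) auto
  finally have "Comp 2 (Comp 4 (Comp 5 (Comp 2 gen gen) t) v) u \<plusminus>\<doteq> Comp 2 (Comp 2 ?X (Comp 3 gen v)) u"
    by (rule Vp.eqv_pm_Comp_left) auto
  also have "\<dots> \<plusminus>\<doteq> Comp 2 ?X (Comp 1 (Comp 3 gen v) u)"
    by (rule Vp.eqv_pm_nested) auto
  finally show ?thesis
    unfolding subst5_def subst3_def by (rule Vp.eqv_pm_Comp_left) auto
qed

lemma subst5_gen_3: "subst5 (Comp 3 gen gen) s u v t \<plusminus>\<doteq> subst3 s u (Comp 2 (Comp 3 gen t) v)"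
proof -
  have "Comp 5 (Comp 3 gen gen) t \<plusminus>\<doteq> Comp 3 gen (Comp 3 gen t)"
    by (rule Vp.eqv_pm_nested) auto
  then have "Comp 4 (Comp 5 (Comp 3 gen gen) t) v \<plusminus>\<doteq> Comp 4 (Comp 3 gen (Comp 3 gen t)) v"
    by (rule Vp.eqv_pm_Comp_left) auto
  also have "\<dots> \<plusminus>\<doteq> Comp 3 gen (Comp 2 (Comp 3 gen t) v)"
    by (rule Vp.eqv_pm_nested) auto
  finally have "Comp 2 (Comp 4 (Comp 5 (Comp 3 gen gen) t) v) u \<plusminus>\<doteq> Comp 2 (Comp 3 gen (Comp 2 (Comp 3 gen t) v)) u"
    by (rule Vp.eqv_pm_Comp_left) auto
  then show ?thesis
    unfolding subst5_def subst3_def by (rule Vp.eqv_pm_Comp_left) auto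
qed

lemma linear_op_subst5: "Vp.linear_op 5 (\<lambda>w. subst5 w s u v t)"
proof -
  have "Vp.linear_op 5 (\<lambda>w. Comp 5 w t)"
    by (rule Vp.linear_op_Comp_left) simp_all
  then have "Vp.linear_op 5 (\<lambda>w. Comp 4 (Comp 5 w t) v)"
    by (rule Vp.linear_op_compose[OF _ Vp.linear_op_Comp_left[of v 4]]) auto
  then have "Vp.linear_op 5 (\<lambda>w. Comp 2 (Comp 4 (Comp 5 w t) v) u)"
    by (rule Vp.linear_op_compose[OF _ Vp.linear_op_Comp_left[of u 2]]) auto
  then show ?thesis
    unfolding subst5_def by (rule Vp.linear_op_compose[OF _ Vp.linear_op_Comp_left[of s 1]]) auto
qed

end

lemma relation_eqv: "Comp 2 gen gen \<doteq> Add (Comp 1 gen gen) (Comp 3 gen gen)"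
proof -
  let ?G = "Vp.presented_component 5 2"
  interpret comm_group ?G by (rule Vp.comm_group_presented) simp
  have c: "Vp.cls (Comp i gen gen) \<in> carrier ?G" if "i \<in> {1, 2, 3}" for i
    using that by (auto simp: Vp.in_presented_component intro!: exI[of _ "Comp i gen gen"])
  have cancel: "b = a \<otimes>\<^bsub>?G\<^esub> d"
    if "(a \<otimes>\<^bsub>?G\<^esub> inv\<^bsub>?G\<^esub> b) \<otimes>\<^bsub>?G\<^esub> d = \<one>\<^bsub>?G\<^esub>"
      "a \<in> carrier ?G" "b \<in> carrier ?G" "d \<in> carrier ?G" for a b d
  proof -
    have "(a \<otimes>\<^bsub>?G\<^esub> d) \<otimes>\<^bsub>?G\<^esub> inv\<^bsub>?G\<^esub> b = \<one>\<^bsub>?G\<^esub>"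
      using that by (simp add: m_ac)
    then have "inv\<^bsub>?G\<^esub> (inv\<^bsub>?G\<^esub> b) = a \<otimes>\<^bsub>?G\<^esub> d"
      using that by (intro inv_equality) auto
    then show ?thesis using that by simp
  qed
  have "(Vp.cls (Comp 1 gen gen) \<otimes>\<^bsub>?G\<^esub> inv\<^bsub>?G\<^esub> Vp.cls (Comp 2 gen gen)) \<otimes>\<^bsub>?G\<^esub> Vp.cls (Comp 3 gen gen) = \<one>\<^bsub>?G\<^esub>"
    using V_relation by (simp add: V_def V_gen_def Vp.circ_cls)
  then have "Vp.cls (Comp 2 gen gen) = Vp.cls (Comp 1 gen gen) \<otimes>\<^bsub>?G\<^esub> Vp.cls (Comp 3 gen gen)"
    by (rule cancel) (use c in auto)
  then show ?thesis by (simp add: Vp.mult_cls Vp.cls_eq_iff)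
qed

text \<open>A trivial middle input leaves an operation bilinear in \<open>s\<close> and
  \<open>t\<close>, whose values on trees are \<open>Qterm (Join x y)\<close> up to sign.\<close>

lemma spanned_subst3_Unit:
  assumes "spanned s" "spanned t"
  shows "spanned (subst3 s Unit t)"
proof -
  have w: "Vp.wft s" "Vp.wft t" using assms by (auto dest: spanned_wft)
  have pm: "subst3 s Unit t \<plusminus>\<doteq> Comp 1 (Comp 3 gen t) s" if "Vp.wft s" "Vp.wft t" for s t
    unfolding subst3_def using that Vp.deg_pos[of t]
    by (intro Vp.eqv_pm_Comp_left Vp.eqv_imp_pm Vp.eqv.Unit_right) auto
  have "spanned (Comp 1 (Comp 3 gen t) s)"
  proof (rule spanned_linear_op[OF _ assms(1)])
    show "Vp.linear_op 1 (Comp 1 (Comp 3 gen t))"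
      using w by (intro Vp.linear_op_Comp_right) auto
    show "1 \<le> Vp.deg s" using w Vp.deg_pos by simp
    fix x
    show "spanned (Comp 1 (Comp 3 gen t) (Qterm x))"
    proof (rule spanned_linear_op[OF _ assms(2)])
      show "Vp.linear_op 1 (\<lambda>t. Comp 1 (Comp 3 gen t) (Qterm x))"
        by (intro Vp.linear_op_compose[OF Vp.linear_op_Comp_right Vp.linear_op_Comp_left]) auto
      show "1 \<le> Vp.deg t" using w Vp.deg_pos by simp
      fix y
      have "Qterm (Join x y) \<plusminus>\<doteq> Comp 1 (Comp 3 gen (Qterm y)) (Qterm x)"
        by (simp only: Qterm.simps) (rule Vp.eqv_pm_sgn, rule Vp.eqv.refl, simp)
      then show "spanned (Comp 1 (Comp 3 gen (Qterm y)) (Qterm x))"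
        using Vp.eqv_pm_sym spanned_pm spanned_Qterm by blast
    qed
  qed
  then show ?thesis using pm[OF w] spanned_pm by blast
qed

text \<open>Induction on the middle tree with arbitrary outer arguments, since pushing
  \<open>u\<close> or \<open>v\<close> aside alters these. Each of the two new terms uses both
  induction hypotheses: one for the altered outer argument, the other for the whole.\<close>

lemma spanned_subst3_Qterm: "spanned s \<Longrightarrow> spanned t \<Longrightarrow> spanned (subst3 s (Qterm x) t)"
proof (induction x arbitrary: s t)
  case Triv
  then show ?case by (simp add: spanned_subst3_Unit)
next
  case (Join u v)
  have w [simp]: "Vp.wft s" "Vp.wft t" using Join.prems by (auto dest: spanned_wft)
  have deg_ge_1 [simp]: "Suc 0 \<le> Vp.deg s" "Suc 0 \<le> Vp.deg t" using Vp.deg_pos[of s] Vp.deg_pos[of t] by simp_all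
  have U: "spanned Unit" using spanned_Qterm[of Triv] by simp
  let ?S = "\<lambda>w. subst5 w s (Qterm u) (Qterm v) t"
  have "spanned (subst3 s (Qterm u) Unit)" using Join.IH(1) Join.prems(1) U by blast
  \<comment> \<open>An open input may be filled with \<open>Unit\<close>, which brings the new left
    argument into the shape of the induction hypothesis.\<close>
  moreover have "Comp 1 (Comp 2 gen (Qterm u)) s \<plusminus>\<doteq> subst3 s (Qterm u) Unit"
    unfolding subst3_def
    by (intro Vp.eqv_pm_Comp_left Vp.eqv_pm_sym[OF Vp.eqv_imp_pm] Vp.eqv.Unit_right) auto
  ultimately have "spanned (Comp 1 (Comp 2 gen (Qterm u)) s)" using spanned_pm by blast
  then have "spanned (subst3 (Comp 1 (Comp 2 gen (Qterm u)) s) (Qterm v) t)"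
    using Join.IH(2) Join.prems(2) by blast
  moreover have "?S (Comp 1 gen gen) \<plusminus>\<doteq> subst3 (Comp 1 (Comp 2 gen (Qterm u)) s) (Qterm v) t"
    by (rule subst5_gen_1) auto
  ultimately have 1: "spanned (?S (Comp 1 gen gen))" using spanned_pm by blast
  have "spanned (subst3 Unit (Qterm v) t)" using Join.IH(2) Join.prems(2) U by blast
  moreover have "Comp 2 (Comp 3 gen t) (Qterm v) \<plusminus>\<doteq> subst3 Unit (Qterm v) t"
    unfolding subst3_def
    by (intro Vp.eqv_pm_sym[OF Vp.eqv_imp_pm] Vp.eqv.Unit_right) auto
  ultimately have "spanned (Comp 2 (Comp 3 gen t) (Qterm v))" using spanned_pm by blast
  then have "spanned (subst3 s (Qterm u) (Comp 2 (Comp 3 gen t) (Qterm v)))"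
    using Join.IH(1) Join.prems(1) by blast
  moreover have "?S (Comp 3 gen gen) \<plusminus>\<doteq> subst3 s (Qterm u) (Comp 2 (Comp 3 gen t) (Qterm v))"
    by (rule subst5_gen_3) auto
  ultimately have 3: "spanned (?S (Comp 3 gen gen))" using spanned_pm by blast
  have lin: "Vp.linear_op 5 ?S" by (rule linear_op_subst5) auto
  \<comment> \<open>Linearity in the quadratic expression turns the relation into a formula for the
    \<open>g \<circ>\<^sub>2 g\<close> term.\<close>
  have "?S (Add (Comp 1 gen gen) (Comp 3 gen gen)) \<doteq> Add (?S (Comp 1 gen gen)) (?S (Comp 3 gen gen))"
    using lin unfolding Vp.linear_op_def by simp
  moreover have "?S (Comp 2 gen gen) \<doteq> ?S (Add (Comp 1 gen gen) (Comp 3 gen gen))"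
    using lin relation_eqv unfolding Vp.linear_op_def by simp
  ultimately have *: "?S (Comp 2 gen gen) \<doteq> Add (?S (Comp 1 gen gen)) (?S (Comp 3 gen gen))"
    by (rule Vp.eqv.trans[rotated])
  have "spanned (Add (?S (Comp 1 gen gen)) (?S (Comp 3 gen gen)))"
    using 1 3 Vp.eqv_invariant[OF *] by (intro spanned_Add) auto
  then have "spanned (?S (Comp 2 gen gen))" by (rule spanned_eqv[OF _ Vp.eqv.sym[OF *]])
  moreover have "?S (Comp 2 gen gen) \<plusminus>\<doteq> subst3 s (Comp 1 (Comp 3 gen (Qterm v)) (Qterm u)) t"
    by (rule subst5_gen_2) auto
  moreover have "subst3 s (Qterm (Join u v)) t \<plusminus>\<doteq> subst3 s (Comp 1 (Comp 3 gen (Qterm v)) (Qterm u)) t"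
    unfolding subst3_def Qterm.simps
    by (intro Vp.eqv_pm_Comp_left Vp.eqv_pm_Comp_right Vp.eqv_pm_sgn[OF Vp.eqv.refl]) auto
  ultimately show ?case using spanned_pm Vp.eqv_pm_sym by blast
qed

lemma spanned_subst3:
  assumes "spanned s" "spanned b" "spanned t"
  shows "spanned (subst3 s b t)"
proof (rule spanned_linear_op[OF _ assms(2)])
  have w: "Vp.wft s" "Vp.wft b" "Vp.wft t" using assms by (auto dest: spanned_wft)
  then have d: "Suc 0 \<le> Vp.deg s" "Suc 0 \<le> Vp.deg b" "Suc 0 \<le> Vp.deg t" using Vp.deg_pos by auto
  show "Vp.linear_op 1 (\<lambda>b. subst3 s b t)"
    unfolding subst3_def using w d
    by (intro Vp.linear_op_compose[OF Vp.linear_op_Comp_right Vp.linear_op_Comp_left]) auto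
  show "1 \<le> Vp.deg b" using d by simp
  show "spanned (subst3 s (Qterm x) t)" for x using assms by (intro spanned_subst3_Qterm)
qed

text \<open>Input \<open>i\<close> lies in the left subtree, is the middle input of the root, or
  lies in the right subtree. The outer cases recurse; the middle one is
  \<open>spanned_subst3\<close>.\<close>

lemma spanned_Comp_Qterm:
  "spanned b \<Longrightarrow> 1 \<le> i \<Longrightarrow> i \<le> Vp.deg (Qterm x) \<Longrightarrow> spanned (Comp i (Qterm x) b)"
proof (induction x arbitrary: i)
  case Triv
  have "b \<doteq> Comp 1 Unit b" by (rule Vp.eqv.sym, rule Vp.eqv.Unit_left, rule spanned_wft, rule Triv.prems)
  with Triv.prems(1) have "spanned (Comp 1 Unit b)" by (rule spanned_eqv)
  moreover have "i = 1" using Triv.prems by simp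
  ultimately show ?case by simp
next
  case (Join x y)
  have w [simp]: "Vp.wft b" using Join.prems by (auto dest: spanned_wft)
  have deg_ge_1 [simp]: "Suc 0 \<le> Vp.deg b" using Vp.deg_pos[of b] by simp
  let ?A = "Comp 3 gen (Qterm y)"
  have split: "spanned (Comp 1 (Comp 3 gen t) s)" if "spanned s" "spanned t" for s t
  proof -
    have "Vp.wft s" "Vp.wft t" using that by (auto dest: spanned_wft)
    then have "Comp 1 (Comp 3 gen t) s \<plusminus>\<doteq> subst3 s Unit t"
      unfolding subst3_def using Vp.deg_pos[of t]
      by (intro Vp.eqv_pm_Comp_left Vp.eqv_pm_sym[OF Vp.eqv_imp_pm] Vp.eqv.Unit_right) auto
    then show ?thesis using spanned_subst3_Unit[OF that] spanned_pm by blast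
  qed
  have Qpm: "Comp i (Qterm (Join x y)) b \<plusminus>\<doteq> Comp i (Comp 1 ?A (Qterm x)) b"
    using Join.prems by (intro Vp.eqv_pm_Comp_left) (auto intro!: Vp.eqv_pm_sgn Vp.eqv.refl)
  consider "i \<le> Vp.deg (Qterm x)" | "i = Vp.deg (Qterm x) + 1" | "i \<ge> Vp.deg (Qterm x) + 2" by linarith
  then have "spanned (Comp i (Comp 1 ?A (Qterm x)) b)"
  proof cases
    case 1
    have "Comp i (Comp 1 ?A (Qterm x)) b \<plusminus>\<doteq> Comp 1 ?A (Comp i (Qterm x) b)"
      using 1 Join.prems by (intro Vp.eqv_pm_nested) auto
    then show ?thesis using spanned_pm split[OF Join.IH(1) spanned_Qterm] 1 Join.prems by blast
  next
    case 2
    have "Comp i (Comp 1 ?A (Qterm x)) b \<plusminus>\<doteq> subst3 (Qterm x) b (Qterm y)"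
      unfolding subst3_def using 2 by (intro Vp.eqv_pm_parallel) auto
    then show ?thesis using spanned_pm spanned_subst3[OF spanned_Qterm Join.prems(1) spanned_Qterm] by blast
  next
    case 3
    \<comment> \<open>\<open>j\<close> numbers the input within the right subtree, after the inputs
      of \<open>x\<close> and the middle input of the root. In \<open>?A\<close> its index is
      \<open>j + 2\<close>, behind the first two inputs of \<open>g\<close>.\<close>
    define j where "j = i - Vp.deg (Qterm x) - 1"
    have j: "1 \<le> j" "j \<le> Vp.deg (Qterm y)" using 3 Join.prems by (auto simp: j_def)
    have "Comp i (Comp 1 ?A (Qterm x)) b \<plusminus>\<doteq> Comp 1 (Comp (j + 2) ?A b) (Qterm x)"
      using 3 j by (intro Vp.eqv_pm_parallel) (auto simp: j_def)
    also have "\<dots> \<plusminus>\<doteq> Comp 1 (Comp 3 gen (Comp j (Qterm y) b)) (Qterm x)"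
      using j by (intro Vp.eqv_pm_Comp_left Vp.eqv_pm_nested) auto
    finally show ?thesis using spanned_pm split[OF spanned_Qterm Join.IH(2)] j Join.prems by blast
  qed
  then show ?case using Qpm spanned_pm by blast
qed

lemma spanned_Comp:
  assumes "spanned s" "spanned t" "1 \<le> i" "i \<le> Vp.deg s"
  shows "spanned (Comp i s t)"
  using assms
  by (intro spanned_linear_op[OF Vp.linear_op_Comp_left, of t i s] spanned_Comp_Qterm spanned_wft)

lemma spanned_all: "Vp.wft t \<Longrightarrow> spanned t"
proof (induction t)
  case Unit
  then show ?case using spanned_Qterm[of Triv] by simp
next
  case (Gen x)
  \<comment> \<open>The generator belongs to the tree with a single vertex.\<close>
  have "Comp 1 (Comp 3 gen Unit) Unit \<doteq> Comp 3 gen Unit" by (intro Vp.eqv.Unit_right) simp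
  also have "\<dots> \<doteq> gen" by (intro Vp.eqv.Unit_right) simp
  finally show ?case using spanned_Qterm[of "Join Triv Triv"] spanned_eqv by (simp add: sgn_term_def)
qed (auto intro: spanned_Zero spanned_Neg spanned_Add spanned_Comp)

section \<open>The basis theorem\<close>

lemma act_sgn_term: "act (sgn_term k t) xs = frag_cmul (psign k) (act t xs)"
  by (simp add: sgn_term_def psign_def)

text \<open>With trivial arguments the middle input of every vertex is trivial, so
  \<open>graft\<close> merely joins and rebuilds \<open>x\<close>. The sign stays unspecified, as
  independence does not depend on it.\<close>

lemma act_Qterm:
  "\<exists>k. act (Qterm x) (replicate (2 * vertices x + 1) Triv) = frag_cmul (psign k) (frag_of x)"
proof (induction x)
  case Triv
  show ?case by (rule exI[of _ 0]) simp
next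
  case (Join x y)
  let ?m = "vertices x" and ?n = "vertices y"
  obtain k where k: "act (Qterm x) (replicate (2 * ?m + 1) Triv) = frag_cmul (psign k) (frag_of x)"
    using Join.IH(1) by blast
  obtain l where l: "act (Qterm y) (replicate (2 * ?n + 1) Triv) = frag_cmul (psign l) (frag_of y)"
    using Join.IH(2) by blast
  let ?g = "Comp 3 gen (Qterm y)"
  \<comment> \<open>The first of the \<open>2 * ?n + 2\<close> trivial trees feeds the middle input
    of \<open>g\<close>, the others feed \<open>Qterm y\<close>; moving \<open>Qterm y\<close> past
    \<open>x\<close> costs the first sign.\<close>
  have g: "act ?g (x # replicate (2 * ?n + 2) Triv) = frag_cmul (psign (int ?n * int ?m) * psign l) (frag_of (Join x y))"
    using act_Comp[of 3 "[x, Triv]" "replicate (2 * ?n + 1) Triv" "Qterm y" gen "[]"] l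
    by (simp add: frag_extend_cmul)
  have "act (Comp 1 ?g (Qterm x)) ([] @ replicate (2 * ?m + 1) Triv @ replicate (2 * ?n + 2) Triv) =
      frag_cmul (psign k) (act ?g (x # replicate (2 * ?n + 2) Triv))"
    using k by (subst act_Comp) (simp_all add: frag_extend_cmul)
  also have "[] @ replicate (2 * ?m + 1) Triv @ replicate (2 * ?n + 2) Triv = replicate (2 * vertices (Join x y) + 1) Triv"
  proof -
    have "2 * ?m + 1 + (2 * ?n + 2) = 2 * vertices (Join x y) + 1" by simp
    then show ?thesis by (simp only: append_Nil replicate_add[symmetric])
  qed
  finally have "act (Comp 1 ?g (Qterm x)) (replicate (2 * vertices (Join x y) + 1) Triv) =
      frag_cmul (psign k) (act ?g (x # replicate (2 * ?n + 2) Triv))" .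
  then have "act (Qterm (Join x y)) (replicate (2 * vertices (Join x y) + 1) Triv) =
      frag_cmul (psign ((int ?m + int ?m * int ?n) + (k + (int ?n * int ?m + l)))) (frag_of (Join x y))"
    by (simp only: Qterm.simps act_sgn_term g frag_cmul_cmul psign_add mult.assoc)
  then show ?case by blast
qed

text \<open>No \<open>Qterm x\<close> has such a degree and weight, so the span there contains only
  zero.\<close>

lemma spanned_imp_eqv_Zero:
  "spanned t \<Longrightarrow> \<nexists>n. Vp.deg t = 2 * n + 1 \<and> Vp.wt t = int n \<Longrightarrow> t \<doteq> Zero (Vp.deg t) (Vp.wt t)"
proof (induction rule: spanned.induct)
  case (spanned_Zero n k)
  then show ?case by (auto intro: Vp.eqv.refl)
next
  case (spanned_Qterm x)
  then show ?case by simp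
next
  case (spanned_Neg t)
  have w: "Vp.wft t" using spanned_Neg.hyps by (rule spanned_wft)
  have "Neg t \<doteq> Neg (Zero (Vp.deg t) (Vp.wt t))" using spanned_Neg by (intro Vp.eqv.cong_Neg) simp
  also have "\<dots> \<doteq> Zero (Vp.deg t) (Vp.wt t)"
    using w Vp.deg_pos[OF w] Vp.eqv.Add_Zero[of "Zero (Vp.deg t) (Vp.wt t)"]
    by (intro Vp.eqv.sym[OF Vp.Add_eq_Zero_imp_eqv_Neg]) simp
  finally show ?case by simp
next
  case (spanned_Add s t)
  have w: "Vp.wft s" using spanned_Add.hyps by (intro spanned_wft)
  let ?z = "Zero (Vp.deg s) (Vp.wt s) :: unit opterm"
  have "Add s t \<doteq> Add ?z ?z" using spanned_Add by (intro Vp.eqv.cong_Add) auto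
  also have "\<dots> \<doteq> ?z" using Vp.eqv.Add_Zero[of ?z] Vp.deg_pos[OF w] by simp
  finally show ?case by simp
next
  case (spanned_eqv s t)
  then show ?case using Vp.eqv_invariant[of s t] Vp.eqv.sym Vp.eqv.trans by metis
qed

lemma component_V: "component V = Vp.presented_component"
  by (simp add: V_def)

text \<open>The map exists by the universal property and is onto by \<open>spanned_all\<close>.
  Acting on trivial arguments sends each \<open>Q x\<close> back to \<open>x\<close> up to sign,
  which gives injectivity.\<close>

lemma free_iso_component:
  obtains h where "h \<in> iso (free_Abelian_group (Y n)) (component V (2 * n + 1) (int n))"
    "\<And>x. x \<in> Y n \<Longrightarrow> h (frag_of x) = Q x"
proof -
  let ?G = "component V (2 * n + 1) (int n)" and ?F = "free_Abelian_group (Y n)"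
  interpret G: comm_group ?G by (rule V.comm_group_component) simp
  interpret F: comm_group ?F by (rule abelian_free_Abelian_group)
  have "Q ` Y n \<subseteq> carrier ?G"
  proof (rule image_subsetI)
    fix x assume "x \<in> Y n"
    then show "Q x \<in> carrier ?G" using Q_closed[of x] by (simp add: Y_def)
  qed
  then obtain h where h: "h \<in> hom ?F ?G" and hQ: "\<And>x. x \<in> Y n \<Longrightarrow> h (frag_of x) = Q x"
    by (rule G.free_Abelian_group_universal[of Q "Y n"]) blast
  interpret h: group_hom ?F ?G h
    by (intro group_hom.intro group_hom_axioms.intro h F.is_group G.is_group)
  \<comment> \<open>Degree and weight are carried through the induction, so that only trees in
    \<open>Y n\<close> occur.\<close>
  have span: "spanned t \<Longrightarrow> Vp.deg t = 2 * n + 1 \<Longrightarrow> Vp.wt t = int n \<Longrightarrow> Vp.cls t \<in> h ` carrier ?F" for t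
  proof (induction rule: spanned.induct)
    case (spanned_Zero m k)
    then have "h \<one>\<^bsub>?F\<^esub> = Vp.cls (Zero m k)"
      by (simp only: h.hom_one) (simp add: component_V Vp.one_presented)
    then show ?case using F.one_closed by (intro image_eqI) (rule sym)
  next
    case (spanned_Qterm x)
    then have x: "x \<in> Y n" by (simp add: Y_def)
    then have "h (frag_of x) = Vp.cls (Qterm x)" by (simp only: hQ Q_eq_cls)
    moreover have "frag_of x \<in> carrier ?F" using x by simp
    ultimately show ?case by (rule image_eqI[OF sym])
  next
    case (spanned_Neg t)
    then have "Vp.cls t \<in> h ` carrier ?F" by simp
    then obtain c where c: "c \<in> carrier ?F" "Vp.cls t = h c" by blast
    then have "h (inv\<^bsub>?F\<^esub> c) = inv\<^bsub>?G\<^esub> Vp.cls t" by (simp only: h.hom_inv)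
    also have "\<dots> = Vp.cls (Neg t)"
      using spanned_Neg.prems spanned_wft[OF spanned_Neg.hyps] by (simp add: component_V Vp.inv_cls)
    finally show ?case using F.inv_closed[OF c(1)] by (intro image_eqI) (rule sym)
  next
    case (spanned_Add s t)
    then have "Vp.cls s \<in> h ` carrier ?F" "Vp.cls t \<in> h ` carrier ?F" by simp_all
    then obtain c d where c: "c \<in> carrier ?F" "Vp.cls s = h c" "d \<in> carrier ?F" "Vp.cls t = h d" by blast
    then have "h (c \<otimes>\<^bsub>?F\<^esub> d) = Vp.cls s \<otimes>\<^bsub>?G\<^esub> Vp.cls t" by (simp only: h.hom_mult)
    also have "\<dots> = Vp.cls (Add s t)"
      using spanned_Add.hyps(3) by (simp add: component_V Vp.mult_cls)
    finally show ?case using F.m_closed[OF c(1,3)] by (intro image_eqI) (rule sym)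
  next
    case (spanned_eqv s t)
    have w: "Vp.wft s" "Vp.deg s = Vp.deg t" "Vp.wt s = Vp.wt t"
      using Vp.eqv_invariant[OF spanned_eqv.hyps(2)] by auto
    then have "Vp.cls s = Vp.cls t" using spanned_eqv.hyps(2) by (simp only: Vp.cls_eq_iff)
    then show ?case using spanned_eqv.IH spanned_eqv.prems w by (simp only:)
  qed
  have surj: "h ` carrier ?F = carrier ?G"
  proof
    show "h ` carrier ?F \<subseteq> carrier ?G" using h.hom_closed by blast
    show "carrier ?G \<subseteq> h ` carrier ?F"
      using span spanned_all by (auto simp: component_V Vp.in_presented_component)
  qed
  \<comment> \<open>An arbitrary representative is evaluated; \<open>act_eqv\<close> shows that the
    choice does not matter.\<close>
  define \<phi> where "\<phi> A = act (SOME t. t \<in> A) (replicate (2 * n + 1) Triv)" for A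
  have \<phi>: "\<phi> (Vp.cls t) = act t (replicate (2 * n + 1) Triv)" if "Vp.wft t" "Vp.deg t = 2 * n + 1" for t
  proof -
    have "(SOME s. s \<in> Vp.cls t) \<in> Vp.cls t" using Vp.cls_self[OF that(1)] by (rule someI)
    then show ?thesis using act_eqv[of t] that by (simp add: Vp.cls_def \<phi>_def)
  qed
  have \<phi>_hom: "\<phi> \<in> hom ?G (free_Abelian_group UNIV)"
    by (rule homI) (auto simp: component_V Vp.in_presented_component Vp.mult_cls \<phi>)
  obtain k where k: "\<And>x. act (Qterm x) (replicate (2 * vertices x + 1) Triv) = frag_cmul (psign (k x)) (frag_of x)"
    using act_Qterm by metis
  define f where "f x = frag_cmul (psign (k x)) (frag_of x)" for x
  have \<phi>h: "\<phi> (h c) = frag_extend f c" if "Poly_Mapping.keys c \<subseteq> Y n" for c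
  proof -
    have hom: "(\<lambda>c. \<phi> (h c)) \<in> hom ?F (free_Abelian_group UNIV)"
      using hom_compose[OF h \<phi>_hom] by (simp add: comp_def)
    have "Poly_Mapping.keys c \<subseteq> Y n \<and> \<phi> (h c) = frag_extend f c"
      using that
    proof (induction c rule: frag_induction)
      case zero
      then show ?case using hom_one[OF hom] by simp
    next
      case (one x)
      then show ?case using hQ[of x] k[of x] by (simp add: \<phi> Q_eq_cls Y_def f_def)
    next
      case (diff a b)
      then show ?case
        using hom_frag_diff[OF hom, of a b] Poly_Mapping.keys_diff[of a b] by (auto simp: frag_extend_diff)
    qed
    then show ?thesis by simp
  qed
  \<comment> \<open>Signs square to 1, so the linear extension of \<open>f\<close> is an involution;
    applied after \<open>\<phi>\<close> it recovers \<open>c\<close> from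
    \<open>h c\<close>.\<close>
  have ff: "frag_extend f (frag_extend f c) = c" for c
    by (induction c rule: frag_linear_induct) (simp_all add: f_def frag_extend_diff frag_extend_cmul)
  have "inj_on h (carrier ?F)"
  proof (rule inj_onI)
    fix c d assume cd: "c \<in> carrier ?F" "d \<in> carrier ?F" "h c = h d"
    then have "frag_extend f c = frag_extend f d" using \<phi>h[of c] \<phi>h[of d] by simp
    then have "frag_extend f (frag_extend f c) = frag_extend f (frag_extend f d)" by (rule arg_cong)
    then show "c = d" by (simp only: ff)
  qed
  then have "h \<in> iso ?F ?G" using h surj unfolding iso_def bij_betw_def by blast
  then show thesis using hQ by (rule that)
qed

text \<open>A tree contributing to degree \<open>2 * n + 1\<close> has \<open>n\<close> vertices,
  hence weight \<open>n\<close>; in any other weight the span is zero.\<close>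

lemma component_V_trivial:
  assumes "k \<noteq> int n"
  shows "carrier (component V (2 * n + 1) k) = {\<one>\<^bsub>component V (2 * n + 1) k\<^esub>}"
proof -
  interpret comm_group "component V (2 * n + 1) k" by (rule V.comm_group_component) simp
  have "A = \<one>\<^bsub>component V (2 * n + 1) k\<^esub>" if A: "A \<in> carrier (component V (2 * n + 1) k)" for A
  proof -
    obtain t where t: "A = Vp.cls t" "Vp.wft t" "Vp.deg t = 2 * n + 1" "Vp.wt t = k"
      using A unfolding component_V Vp.in_presented_component by blast
    have "t \<doteq> Zero (Vp.deg t) (Vp.wt t)"
      using t assms by (intro spanned_imp_eqv_Zero spanned_all) auto
    then have "A = Vp.cls (Zero (2 * n + 1) k)"
      using t by (simp only: Vp.cls_eq_iff)
    then show ?thesis by (simp only: component_V Vp.one_presented)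
  qed
  then show ?thesis using one_closed by blast
qed

section \<open>From the component of weight \<open>n\<close> to the whole group of degree
  \<open>2 * n + 1\<close>\<close>

lemma comm_group_total_V: "1 \<le> n \<Longrightarrow> comm_group (total_group V n)"
proof -
  assume n: "1 \<le> n"
  then have G: "comm_group (component V n k)" for k by (rule V.comm_group_component)
  then have grp: "group (component V n k)" for k by (rule comm_group.axioms(2))
  have "group (total_group V n)" unfolding total_group_def using grp by (intro sum_group)
  then show ?thesis
  proof (rule group.group_comm_groupI)
    fix x y assume "x \<in> carrier (total_group V n)" "y \<in> carrier (total_group V n)"
    then have "x k \<in> carrier (component V n k)" "y k \<in> carrier (component V n k)" for k
      using grp by (auto simp: total_group_def carrier_sum_group)
    then have "x k \<otimes>\<^bsub>component V n k\<^esub> y k = y k \<otimes>\<^bsub>component V n k\<^esub> x k" for k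
      by (intro comm_monoid.m_comm comm_group.axioms(1) G)
    then show "x \<otimes>\<^bsub>total_group V n\<^esub> y = y \<otimes>\<^bsub>total_group V n\<^esub> x"
      by (simp add: total_group_def)
  qed
qed

text \<open>The components of all other weights vanish by \<open>component_V_trivial\<close>, so one
  summand is the whole direct sum.\<close>

lemma incl_iso:
  "incl V (2 * n + 1) (int n) \<in> iso (component V (2 * n + 1) (int n)) (total_group V (2 * n + 1))"
proof -
  let ?G = "component V (2 * n + 1)" and ?i = "incl V (2 * n + 1) (int n)"
  have grp: "group (?G k)" for k
    by (rule comm_group.axioms(2), rule V.comm_group_component) simp
  have one: "\<one>\<^bsub>?G k\<^esub> \<in> carrier (?G k)" for k
    using grp[of k] by (simp add: group.is_monoid monoid.one_closed)
  have T: "carrier (total_group V (2 * n + 1)) = {v. (\<forall>k. v k \<in> carrier (?G k)) \<and> finite {k. v k \<noteq> \<one>\<^bsub>?G k\<^esub>}}"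
    using grp by (auto simp: total_group_def carrier_sum_group PiE_UNIV_domain Pi_def)
  have i: "?i a \<in> carrier (total_group V (2 * n + 1))" if "a \<in> carrier (?G (int n))" for a
  proof -
    have "{k. ?i a k \<noteq> \<one>\<^bsub>?G k\<^esub>} \<subseteq> {int n}" by (auto simp: incl_def)
    then have "finite {k. ?i a k \<noteq> \<one>\<^bsub>?G k\<^esub>}" by (rule finite_subset) simp
    moreover have "?i a k \<in> carrier (?G k)" for k using that one by (simp add: incl_def)
    ultimately show ?thesis unfolding T by blast
  qed
  have "?i \<in> hom (?G (int n)) (total_group V (2 * n + 1))"
  proof (rule homI)
    fix a b assume "a \<in> carrier (?G (int n))" "b \<in> carrier (?G (int n))"
    show "?i (a \<otimes>\<^bsub>?G (int n)\<^esub> b) = ?i a \<otimes>\<^bsub>total_group V (2 * n + 1)\<^esub> ?i b"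
      using monoid.l_one[OF group.is_monoid[OF grp] one] by (simp add: incl_def total_group_def fun_eq_iff)
  qed (rule i)
  moreover have "bij_betw ?i (carrier (?G (int n))) (carrier (total_group V (2 * n + 1)))"
  proof (rule bij_betw_byWitness[where f' = "\<lambda>v. v (int n)"])
    show "\<forall>v\<in>carrier (total_group V (2 * n + 1)). ?i (v (int n)) = v"
    proof (intro ballI ext)
      fix v k assume "v \<in> carrier (total_group V (2 * n + 1))"
      then have "v k \<in> carrier (?G k)" unfolding T by blast
      then show "?i (v (int n)) k = v k"
        using component_V_trivial[of k n] by (cases "k = int n") (simp_all add: incl_def)
    qed
    show "(\<lambda>v. v (int n)) ` carrier (total_group V (2 * n + 1)) \<subseteq> carrier (?G (int n))"
      unfolding T by blast
  qed (use i in \<open>auto simp: incl_def\<close>)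
  ultimately show ?thesis by (simp add: iso_def)
qed

theorem proposition2p4:
  fixes n :: nat
  shows "abelian_basis (total_group V (2 * n + 1)) (Y n) (\<lambda>x. incl V (2 * n + 1) (int n) (Q x))"
proof -
  obtain h where h: "h \<in> iso (free_Abelian_group (Y n)) (component V (2 * n + 1) (int n))"
    and hQ: "\<And>x. x \<in> Y n \<Longrightarrow> h (frag_of x) = Q x"
    using free_iso_component[of n] by blast
  show ?thesis
  proof (rule abelian_basisI)
    show "comm_group (total_group V (2 * n + 1))" by (rule comm_group_total_V) simp
    show "incl V (2 * n + 1) (int n) \<circ> h \<in> iso (free_Abelian_group (Y n)) (total_group V (2 * n + 1))"
      using h incl_iso by (rule iso_set_trans)
  qed (simp add: hQ)
qed

end
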